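(* For all integers $l,k\ge 0$, the additional flow $\partial_{t^*_{l,k}}$ of the KdV hierarchy, defined by $\partial_{t^*_{l,k}}\mathcal S=-(e^{l\mathcal M}q^{k\mathcal L})_-\mathcal S$, is a symmetry of the KdV hierarchy; that is, it commutes with all flows $\partial_{t_n}$, $n=1,3,5,\dots$, of the KdV hierarchy.
   Context: Work with (formal) pseudo-differential operators in $\partial=\partial/\partial x$, with product given by $\partial^n\circ f=\sum_{j\ge 0}\binom nj(\partial^jf)\partial^{n-j}$, $n\in\mathbb Z$; $A_+$ is the part of $A$ with powers $\partial^i$, $i\ge0$, and $A_-=A-A_+$. KdV hierarchy: the Lax operator is $\mathcal L=\partial^2+u$, with $u$ depending on $t=(t_1,t_3,t_5,\dots)$, $t_1$ identified with $x$, satisfying $\partial\mathcal L/\partial t_n=[(\mathcal L^{n/2})_+,\mathcal L]$, $n=1,3,5,\dots$. It is written $\mathcal L=\mathcal S\partial^2\mathcal S^{-1}$ with $\mathcal S=1+\sum_{k\ge1}\tilde\omega_k\partial^{-k}$, $\mathcal L^{n/2}=\mathcal S\partial^n\mathcal S^{-1}$, and $\partial\mathcal S/\partial t_n=-(\mathcal L^{n/2})_-\mathcal S$ for odd $n\ge1$. Orlov–Shulman operator: $\mathcal M=\mathcal S\Gamma_{kdv}\mathcal S^{-1}$ with $\Gamma_{kdv}=\frac12\sum_{i\ge1,\ i\text{ odd}}it_i\partial^{i-2}$; one has $[\mathcal L,\mathcal M]=1$. Let $q$ be a parameter; $e^{m\mathcal M}q^{n\mathcal L}$ denotes the formal series $\sum_{p,s\ge0}\frac{m^p(n\log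 q)^s}{p!\,s!}\mathcal M^p\mathcal L^s$. The additional flows are defined by $\partial_{t^*_{m,n}}\mathcal S=-(e^{m\mathcal M}q^{n\mathcal L})_-\mathcal S$; equivalently $\partial_{t^*_{m,n}}\mathcal L=-[(e^{m\mathcal M}q^{n\mathcal L})_-,\mathcal L]$ and $\partial_{t^*_{m,n}}\mathcal M=-[(e^{m\mathcal M}q^{n\mathcal L})_-,\mathcal M]$. *)

theory Defs
  imports
    "HOL-Computational_Algebra.Computational_Algebra"
    "HOL-Library.Multiset"
begin

section \<open>Functions of x\<close>

text \<open>
  The functions of \<open>x\<close> form an arbitrary commutative differential algebra containing \<open>x\<close> itself
  (formal power or Laurent series, smooth functions, meromorphic functions, ...).
\<close>

class function_algebra = comm_ring_1 + real_algebra_1 +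
  fixes ddx :: "'a \<Rightarrow> 'a"
    and xvar :: 'a
  assumes ddx_add: "ddx (a + b) = ddx a + ddx b"
    and ddx_scaleR: "ddx (r *\<^sub>R a) = r *\<^sub>R ddx a"
    and ddx_mult: "ddx (a * b) = ddx a * b + a * ddx b"
    and ddx_xvar: "ddx xvar = 1"
begin

lemma ddx_0 [simp]: "ddx 0 = 0"
  using ddx_add[of 0 0] by simp

lemma ddx_1 [simp]: "ddx 1 = 0"
  using ddx_mult[of 1 1] by simp

lemma ddxn_0 [simp]: "(ddx ^^ n) 0 = 0"
  by (induction n) auto

lemma ddxn_1: "(ddx ^^ n) 1 = (if n = 0 then 1 else 0)"
  by (induction n) auto

lemma ddxn_add: "(ddx ^^ n) (a + b) = (ddx ^^ n) a + (ddx ^^ n) b"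
  by (induction n) (auto simp: ddx_add)

lemma ddxn_scaleR: "(ddx ^^ n) (r *\<^sub>R a) = r *\<^sub>R (ddx ^^ n) a"
  by (induction n) (auto simp: ddx_scaleR)

lemma ddxn_sum: "(ddx ^^ n) (sum f A) = (\<Sum>i\<in>A. (ddx ^^ n) (f i))"
  by (induction A rule: infinite_finite_induct) (auto simp: ddxn_add)

end

lemma ddxn_mult:
  fixes a b :: "'a::function_algebra"
  shows "(ddx ^^ n) (a * b) =
    (\<Sum>j\<le>n. real (n choose j) *\<^sub>R ((ddx ^^ j) a * (ddx ^^ (n - j)) b))"
proof (induction n)
  case 0
  then show ?case by simp
next
  case (Suc n)
  let ?t = "\<lambda>j. (ddx ^^ j) a * (ddx ^^ (Suc n - j)) b"
  have "(ddx ^^ Suc n) (a * b) =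
      ddx (\<Sum>j\<le>n. real (n choose j) *\<^sub>R ((ddx ^^ j) a * (ddx ^^ (n - j)) b))"
    by (simp add: Suc)
  also have "\<dots> = (\<Sum>j\<le>n. real (n choose j) *\<^sub>R ?t (Suc j)) + (\<Sum>j\<le>n. real (n choose j) *\<^sub>R ?t j)"
  proof -
    have "ddx (sum f A) = (\<Sum>j\<in>A. ddx (f j))" for f :: "nat \<Rightarrow> 'a" and A
      using ddxn_sum[of 1 f A] by simp
    then show ?thesis
      by (simp add: ddx_scaleR ddx_mult scaleR_add_right sum.distrib Suc_diff_le)
  qed
  also have "(\<Sum>j\<le>n. real (n choose j) *\<^sub>R ?t j) =
      ?t 0 + (\<Sum>j\<le>n. real (n choose Suc j) *\<^sub>R ?t (Suc j))"
  proof -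
    have "(\<Sum>j\<le>n. real (n choose j) *\<^sub>R ?t j) = (\<Sum>j\<le>Suc n. real (n choose j) *\<^sub>R ?t j)"
      by simp
    also have "\<dots> = ?t 0 + (\<Sum>j\<le>n. real (n choose Suc j) *\<^sub>R ?t (Suc j))"
      by (subst sum.atMost_Suc_shift) simp
    finally show ?thesis .
  qed
  also have "(\<Sum>j\<le>n. real (n choose j) *\<^sub>R ?t (Suc j)) +
      (?t 0 + (\<Sum>j\<le>n. real (n choose Suc j) *\<^sub>R ?t (Suc j))) =
      ?t 0 + (\<Sum>j\<le>n. real (Suc n choose Suc j) *\<^sub>R ?t (Suc j))"
    by (simp add: sum.distrib scaleR_add_left)
  also have "\<dots> = (\<Sum>j\<le>Suc n. real (Suc n choose j) *\<^sub>R ?t j)"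
    by (subst sum.atMost_Suc_shift) simp
  finally show ?case .
qed


section \<open>Pseudo-differential operators in x\<close>

text \<open>The function \<open>f\<close> stands for the formal sum of the \<open>f i \<partial>\<^sup>i\<close>.\<close>

typedef (overloaded) 'a psido = "{f :: int \<Rightarrow> 'a::zero. \<exists>N. \<forall>i>N. f i = 0}"
  morphisms coef Psido
  by (rule exI[of _ "\<lambda>_. 0"]) simp

setup_lifting type_definition_psido

lemma psido_eqI: "(\<And>i. coef P i = coef Q i) \<Longrightarrow> P = Q"
  by (simp add: coef_inject[symmetric] fun_eq_iff)

lemma coef_bound: obtains N where "\<And>i. i > N \<Longrightarrow> coef P i = 0"
  using coef[of P] by auto

text \<open>
  From \<open>\<partial>\<^sup>i \<circ> g = (\<Sum>j. binom i j (\<partial>\<^sup>j g) \<partial>\<^bsup>i-j\<^esup>)\<close>; only finitely many pairs \<open>(i, j)\<close> contribute to the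
  coefficient of \<open>\<partial>\<^sup>n\<close>.
\<close>

definition psido_mult :: "(int \<Rightarrow> 'a::function_algebra) \<Rightarrow> (int \<Rightarrow> 'a) \<Rightarrow> int \<Rightarrow> 'a" where
  "psido_mult f g n = (\<Sum>(i, j) | f i \<noteq> 0 \<and> g (n - i + int j) \<noteq> 0.
     (real_of_int i gchoose j) *\<^sub>R (f i * (ddx ^^ j) (g (n - i + int j))))"

lemma psido_mult_box:
  fixes f g :: "int \<Rightarrow> 'a::function_algebra"
  assumes f: "\<And>i. i > N \<Longrightarrow> f i = 0" and g: "\<And>i. i > K \<Longrightarrow> g i = 0"
    and lo: "lo \<le> n - K" and hi: "N \<le> hi" and B: "N + K - n \<le> int B"
  shows "psido_mult f g n = (\<Sum>i\<in>{lo..hi}. \<Sum>j\<le>B.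
     (real_of_int i gchoose j) *\<^sub>R (f i * (ddx ^^ j) (g (n - i + int j))))"
proof -
  have "i \<in> {lo..hi} \<and> j \<le> B" if "f i \<noteq> 0" "g (n - i + int j) \<noteq> 0" for i j
  proof -
    have "i \<le> N" using f that by force
    moreover have "n - i + int j \<le> K" using g that by force
    ultimately show ?thesis using lo hi B by auto
  qed
  then show ?thesis
    unfolding psido_mult_def sum.cartesian_product
    by (intro sum.mono_neutral_cong_left) auto
qed

lemma psido_mult_eq_0:
  fixes f g :: "int \<Rightarrow> 'a::function_algebra"
  assumes f: "\<And>i. i > N \<Longrightarrow> f i = 0" and g: "\<And>i. i > K \<Longrightarrow> g i = 0" and n: "n > N + K"
  shows "psido_mult f g n = 0"
proof -
  have "False" if "f i \<noteq> 0" "g (n - i + int j) \<noteq> 0" for i j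
  proof -
    have "i \<le> N" using f that by force
    moreover have "n - i + int j \<le> K" using g that by force
    ultimately show ?thesis using n by auto
  qed
  then have *: "{(i, j). f i \<noteq> 0 \<and> g (n - i + int j) \<noteq> 0} = {}" by auto
  show ?thesis unfolding psido_mult_def * by simp
qed

lemma psido_mult_coeff_identity:
  "(\<Sum>a\<le>r. (real_of_int i gchoose (a + j)) * real ((a + j) choose j) * (real_of_int k gchoose (r - a)))
   = (real_of_int i gchoose j) * (real_of_int (i + k - int j) gchoose r)"
proof -
  have "(\<Sum>a\<le>r. (real_of_int i gchoose (a + j)) * real ((a + j) choose j) * (real_of_int k gchoose (r - a)))
     = (\<Sum>a\<le>r. (real_of_int i gchoose j) * (((real_of_int i - real j) gchoose a) * (real_of_int k gchoose (r - a))))"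
  proof (rule sum.cong[OF refl])
    fix a
    have "(real_of_int i gchoose (a + j)) * real ((a + j) choose j) =
        (real_of_int i gchoose j) * ((real_of_int i - real j) gchoose a)"
      using gbinomial_trinomial_revision[of j "a + j" "real_of_int i"]
      by (simp add: binomial_gbinomial)
    then show "(real_of_int i gchoose (a + j)) * real ((a + j) choose j) * (real_of_int k gchoose (r - a))
       = (real_of_int i gchoose j) * (((real_of_int i - real j) gchoose a) * (real_of_int k gchoose (r - a)))"
      by simp
  qed
  also have "\<dots> = (real_of_int i gchoose j) * ((real_of_int i - real j + real_of_int k) gchoose r)"
    using gbinomial_Vandermonde[of "real_of_int i - real j" "real_of_int k" r]
    by (simp add: sum_distrib_left[symmetric] atMost_atLeast0)
  finally show ?thesis by (simp add: algebra_simps)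
qed

lemma sum_triangle_square:
  fixes X :: "nat \<Rightarrow> nat \<Rightarrow> 'b::comm_monoid_add"
  assumes "\<And>a b. a + b > B - j \<Longrightarrow> X a b = 0" "j \<le> B"
  shows "(\<Sum>a\<le>B - j. \<Sum>b\<le>B. X a b) = (\<Sum>r\<le>B. \<Sum>a\<le>r. X a (r - a))"
proof -
  have X0: "X a b = 0" if "\<not> a + b \<le> B - j" for a b
    using assms(1) that by (meson not_le)
  have "(\<Sum>r\<le>B. \<Sum>a\<le>r. X a (r - a)) = (\<Sum>(r, a)\<in>(SIGMA r:{..B}. {..r}). X a (r - a))"
    by (subst sum.Sigma) auto
  also have "\<dots> = (\<Sum>(a, b) | a + b \<le> B. X a b)"
    by (rule sum.reindex_bij_witness[of _ "\<lambda>(a, b). (a + b, a)" "\<lambda>(r, a). (a, r - a)"]) auto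
  also have "\<dots> = (\<Sum>(a, b) | a + b \<le> B - j. X a b)"
  proof (rule sum.mono_neutral_right)
    have "{(a, b). a + b \<le> B} \<subseteq> {..B} \<times> {..B}" by auto
    then show "finite {(a, b). a + b \<le> B}" by (rule finite_subset) auto
    show "\<forall>i\<in>{(a, b). a + b \<le> B} - {(a, b). a + b \<le> B - j}. (case i of (a, b) \<Rightarrow> X a b) = 0"
      using X0 by auto
  qed auto
  also have "\<dots> = (\<Sum>(a, b)\<in>{..B - j} \<times> {..B}. X a b)"
  proof (rule sum.mono_neutral_left)
    show "\<forall>i\<in>{..B - j} \<times> {..B} - {(a, b). a + b \<le> B - j}. (case i of (a, b) \<Rightarrow> X a b) = 0"
      using X0 by auto
  qed auto
  finally show ?thesis by (simp add: sum.cartesian_product)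
qed

lemma psido_mult_assoc:
  fixes p q w :: "int \<Rightarrow> 'a::function_algebra"
  assumes p: "\<And>i. i > N \<Longrightarrow> p i = 0" and q: "\<And>i. i > K \<Longrightarrow> q i = 0" and w: "\<And>i. i > M \<Longrightarrow> w i = 0"
  shows "psido_mult (psido_mult p q) w n = psido_mult p (psido_mult q w) n"
proof -
  define B where "B = nat (N + K + M - n)"
  have B: "N + K + M - n \<le> int B" by (simp add: B_def)
  define X where "X i j k r = p i * (ddx ^^ j) (q k) * (ddx ^^ r) (w (n - i - k + int j + int r))"
    for i k and j r :: nat
  define I where "I = {n - M - K..N}"
  define Kk where "Kk = {n - N - M..K}"
  have X0: "X i j k r = 0" if "k > K \<or> i > N \<or> n - i - k + int j + int r > M" for i j k r
    using that p q w by (auto simp: X_def)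
  have "psido_mult (psido_mult p q) w n = (\<Sum>m\<in>{n - M..N + K}. \<Sum>r\<le>B.
     (real_of_int m gchoose r) *\<^sub>R (psido_mult p q m * (ddx ^^ r) (w (n - m + int r))))"
    by (rule psido_mult_box[of "N + K" _ M]) (use p q w B in \<open>auto intro: psido_mult_eq_0\<close>)
  also have "\<dots> = (\<Sum>m\<in>{n - M..N + K}. \<Sum>r\<le>B.
     (real_of_int m gchoose r) *\<^sub>R ((\<Sum>i\<in>I. \<Sum>j\<le>B. (real_of_int i gchoose j) *\<^sub>R
        (p i * (ddx ^^ j) (q (m - i + int j)))) * (ddx ^^ r) (w (n - m + int r))))"
    unfolding I_def
    by (intro sum.cong refl arg_cong[where f = "(*\<^sub>R) _"] arg_cong2[where f = "(*)"]
        psido_mult_box[of N _ K]) (use p q B in auto)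
  also have "\<dots> = (\<Sum>m\<in>{n - M..N + K}. \<Sum>r\<le>B. \<Sum>i\<in>I. \<Sum>j\<le>B.
     ((real_of_int m gchoose r) * (real_of_int i gchoose j)) *\<^sub>R X i j (m - i + int j) r)"
    unfolding sum_distrib_right scaleR_sum_right
    by (intro sum.cong refl) (simp add: X_def)
  also have "\<dots> = (\<Sum>i\<in>I. \<Sum>j\<le>B. \<Sum>m\<in>{n - M..N + K}. \<Sum>r\<le>B.
     ((real_of_int m gchoose r) * (real_of_int i gchoose j)) *\<^sub>R X i j (m - i + int j) r)"
  proof -
    have "(\<Sum>m\<in>U. \<Sum>r\<in>R. \<Sum>i\<in>I. \<Sum>j\<in>J. F m r i j) = (\<Sum>i\<in>I. \<Sum>j\<in>J. \<Sum>m\<in>U. \<Sum>r\<in>R. F m r i j)"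
      for F :: "int \<Rightarrow> nat \<Rightarrow> int \<Rightarrow> nat \<Rightarrow> 'a" and U R J
    proof -
      have "(\<Sum>m\<in>U. \<Sum>r\<in>R. \<Sum>i\<in>I. \<Sum>j\<in>J. F m r i j) = (\<Sum>m\<in>U. \<Sum>i\<in>I. \<Sum>r\<in>R. \<Sum>j\<in>J. F m r i j)"
        by (intro sum.cong refl sum.swap)
      also have "\<dots> = (\<Sum>i\<in>I. \<Sum>m\<in>U. \<Sum>j\<in>J. \<Sum>r\<in>R. F m r i j)"
        by (subst sum.swap) (intro sum.cong refl sum.swap)
      also have "\<dots> = (\<Sum>i\<in>I. \<Sum>j\<in>J. \<Sum>m\<in>U. \<Sum>r\<in>R. F m r i j)"
        by (intro sum.cong refl sum.swap)
      finally show ?thesis .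
    qed
    then show ?thesis .
  qed
  also have "\<dots> = (\<Sum>i\<in>I. \<Sum>j\<le>B. \<Sum>k\<in>Kk. \<Sum>r\<le>B.
     ((real_of_int (i + k - int j) gchoose r) * (real_of_int i gchoose j)) *\<^sub>R X i j k r)"
  proof (rule sum.cong[OF refl], rule sum.cong[OF refl])
    fix i j assume i: "i \<in> I" and "j \<in> {..B}"
    let ?G = "\<lambda>k. \<Sum>r\<le>B. ((real_of_int (i + k - int j) gchoose r) * (real_of_int i gchoose j)) *\<^sub>R X i j k r"
    have "(\<Sum>m\<in>{n - M..N + K}. \<Sum>r\<le>B.
        ((real_of_int m gchoose r) * (real_of_int i gchoose j)) *\<^sub>R X i j (m - i + int j) r)
      = (\<Sum>k\<in>{n - M - i + int j..N + K - i + int j}. ?G k)"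
      by (rule sum.reindex_bij_witness[of _ "\<lambda>k. k + i - int j" "\<lambda>m. m - i + int j"])
        (auto simp: algebra_simps)
    also have "\<dots> = (\<Sum>k\<in>{n - M - i + int j..K}. ?G k)"
      using i by (intro sum.mono_neutral_right) (auto simp: I_def X0 intro!: sum.neutral)
    also have "\<dots> = (\<Sum>k\<in>Kk. ?G k)"
      using i by (intro sum.mono_neutral_left) (auto simp: I_def Kk_def X0 intro!: sum.neutral)
    finally show "(\<Sum>m\<in>{n - M..N + K}. \<Sum>r\<le>B.
        ((real_of_int m gchoose r) * (real_of_int i gchoose j)) *\<^sub>R X i j (m - i + int j) r) =
        (\<Sum>k\<in>Kk. ?G k)" .
  qed
  finally have L: "psido_mult (psido_mult p q) w n = \<dots>" .
  have "psido_mult p (psido_mult q w) n = (\<Sum>i\<in>I. \<Sum>s\<le>B.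
     (real_of_int i gchoose s) *\<^sub>R (p i * (ddx ^^ s) (psido_mult q w (n - i + int s))))"
    unfolding I_def
    by (rule psido_mult_box[of N _ "K + M"]) (use p q w B in \<open>auto intro: psido_mult_eq_0\<close>)
  also have "\<dots> = (\<Sum>i\<in>I. \<Sum>s\<le>B. (real_of_int i gchoose s) *\<^sub>R (p i * (ddx ^^ s)
     (\<Sum>k\<in>Kk. \<Sum>b\<le>B. (real_of_int k gchoose b) *\<^sub>R
        (q k * (ddx ^^ b) (w (n - i + int s - k + int b))))))"
    unfolding Kk_def
    by (intro sum.cong refl arg_cong[where f = "(*\<^sub>R) _"] arg_cong[where f = "(*) _"]
        arg_cong[where f = "ddx ^^ _"] psido_mult_box[of K _ M]) (use q w B in \<open>auto simp: I_def\<close>)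
  also have "\<dots> = (\<Sum>i\<in>I. \<Sum>s\<le>B. \<Sum>k\<in>Kk. \<Sum>b\<le>B. \<Sum>j\<le>s.
     ((real_of_int i gchoose s) * (real (s choose j)) * (real_of_int k gchoose b)) *\<^sub>R X i j k (s - j + b))"
    by (intro sum.cong refl)
      (simp add: ddxn_sum ddxn_scaleR ddxn_mult sum_distrib_left scaleR_sum_right X_def
        funpow_add[symmetric] algebra_simps of_nat_diff flip: comp_apply[of "ddx ^^ _" "ddx ^^ _"])
  also have "\<dots> = (\<Sum>i\<in>I. \<Sum>k\<in>Kk. \<Sum>s\<le>B. \<Sum>j\<le>s. \<Sum>b\<le>B.
     ((real_of_int i gchoose s) * (real (s choose j)) * (real_of_int k gchoose b)) *\<^sub>R X i j k (s - j + b))"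
    by (intro sum.cong refl, subst sum.swap, intro sum.cong refl sum.swap)
  also have "\<dots> = (\<Sum>i\<in>I. \<Sum>k\<in>Kk. \<Sum>j\<le>B. \<Sum>a\<le>B - j. \<Sum>b\<le>B.
     ((real_of_int i gchoose (a + j)) * (real ((a + j) choose j)) * (real_of_int k gchoose b)) *\<^sub>R X i j k (a + b))"
  proof (rule sum.cong[OF refl], rule sum.cong[OF refl])
    fix i k assume "i \<in> I" "k \<in> Kk"
    have "(\<Sum>s\<le>B. \<Sum>j\<le>s. F s j) = (\<Sum>j\<le>B. \<Sum>a\<le>B - j. F (a + j) j)" for F :: "nat \<Rightarrow> nat \<Rightarrow> 'a"
      unfolding sum.Sigma[OF finite_atMost ballI[OF finite_atMost]]
      by (rule sum.reindex_bij_witness[of _ "\<lambda>(j, a). (a + j, j)" "\<lambda>(s, j). (j, s - j)"]) auto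
    from this[of "\<lambda>s j. \<Sum>b\<le>B.
       ((real_of_int i gchoose s) * (real (s choose j)) * (real_of_int k gchoose b)) *\<^sub>R X i j k (s - j + b)"]
    show "(\<Sum>s\<le>B. \<Sum>j\<le>s. \<Sum>b\<le>B.
       ((real_of_int i gchoose s) * (real (s choose j)) * (real_of_int k gchoose b)) *\<^sub>R X i j k (s - j + b)) =
      (\<Sum>j\<le>B. \<Sum>a\<le>B - j. \<Sum>b\<le>B.
     ((real_of_int i gchoose (a + j)) * (real ((a + j) choose j)) * (real_of_int k gchoose b)) *\<^sub>R X i j k (a + b))"
      by simp
  qed
  also have "\<dots> = (\<Sum>i\<in>I. \<Sum>k\<in>Kk. \<Sum>j\<le>B. \<Sum>r\<le>B.
     ((real_of_int i gchoose j) * (real_of_int (i + k - int j) gchoose r)) *\<^sub>R X i j k r)"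
  proof (rule sum.cong[OF refl], rule sum.cong[OF refl], rule sum.cong[OF refl])
    fix i k j assume ikj: "i \<in> I" "k \<in> Kk" "j \<in> {..B}"
    have "(\<Sum>a\<le>B - j. \<Sum>b\<le>B.
        ((real_of_int i gchoose (a + j)) * (real ((a + j) choose j)) * (real_of_int k gchoose b)) *\<^sub>R X i j k (a + b))
      = (\<Sum>r\<le>B. \<Sum>a\<le>r.
        ((real_of_int i gchoose (a + j)) * (real ((a + j) choose j)) * (real_of_int k gchoose (r - a))) *\<^sub>R X i j k (a + (r - a)))"
      by (rule sum_triangle_square) (use ikj B in \<open>auto simp: I_def Kk_def intro!: X0\<close>)
    also have "\<dots> = (\<Sum>r\<le>B. (\<Sum>a\<le>r.
        (real_of_int i gchoose (a + j)) * (real ((a + j) choose j)) * (real_of_int k gchoose (r - a))) *\<^sub>R X i j k r)"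
      by (simp add: scaleR_sum_left)
    also have "\<dots> = (\<Sum>r\<le>B. ((real_of_int i gchoose j) * (real_of_int (i + k - int j) gchoose r)) *\<^sub>R X i j k r)"
      by (simp only: psido_mult_coeff_identity)
    finally show "(\<Sum>a\<le>B - j. \<Sum>b\<le>B.
        ((real_of_int i gchoose (a + j)) * (real ((a + j) choose j)) * (real_of_int k gchoose b)) *\<^sub>R X i j k (a + b))
      = \<dots>" .
  qed
  also have "\<dots> = (\<Sum>i\<in>I. \<Sum>j\<le>B. \<Sum>k\<in>Kk. \<Sum>r\<le>B.
     ((real_of_int (i + k - int j) gchoose r) * (real_of_int i gchoose j)) *\<^sub>R X i j k r)"
    by (subst sum.swap[of _ Kk]) (simp add: mult.commute)
  finally show ?thesis using L by simp
qed

instantiation psido :: (function_algebra) real_algebra_1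
begin

lift_definition zero_psido :: "'a psido" is "\<lambda>_. 0" by simp

lift_definition one_psido :: "'a psido" is "\<lambda>i. if i = 0 then 1 else 0"
  by (auto intro!: exI[of _ 0])

lift_definition plus_psido :: "'a psido \<Rightarrow> 'a psido \<Rightarrow> 'a psido" is "\<lambda>f g i. f i + g i"
proof -
  fix f g :: "int \<Rightarrow> 'a"
  assume "\<exists>N. \<forall>i>N. f i = 0" "\<exists>N. \<forall>i>N. g i = 0"
  then obtain N K where "\<forall>i>N. f i = 0" "\<forall>i>K. g i = 0" by blast
  then show "\<exists>N. \<forall>i>N. f i + g i = 0" by (intro exI[of _ "max N K"]) auto
qed

lift_definition minus_psido :: "'a psido \<Rightarrow> 'a psido \<Rightarrow> 'a psido" is "\<lambda>f g i. f i - g i"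
proof -
  fix f g :: "int \<Rightarrow> 'a"
  assume "\<exists>N. \<forall>i>N. f i = 0" "\<exists>N. \<forall>i>N. g i = 0"
  then obtain N K where "\<forall>i>N. f i = 0" "\<forall>i>K. g i = 0" by blast
  then show "\<exists>N. \<forall>i>N. f i - g i = 0" by (intro exI[of _ "max N K"]) auto
qed

lift_definition uminus_psido :: "'a psido \<Rightarrow> 'a psido" is "\<lambda>f i. - f i" by auto

lift_definition scaleR_psido :: "real \<Rightarrow> 'a psido \<Rightarrow> 'a psido" is "\<lambda>r f i. r *\<^sub>R f i" by auto

lift_definition times_psido :: "'a psido \<Rightarrow> 'a psido \<Rightarrow> 'a psido" is psido_mult
proof -
  fix f g :: "int \<Rightarrow> 'a"
  assume "\<exists>N. \<forall>i>N. f i = 0" "\<exists>N. \<forall>i>N. g i = 0"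
  then obtain N K where "\<forall>i>N. f i = 0" "\<forall>i>K. g i = 0" by blast
  then show "\<exists>N. \<forall>i>N. psido_mult f g i = 0"
    by (intro exI[of _ "N + K"]) (auto intro: psido_mult_eq_0)
qed

lemma coef_mult_box:
  fixes P Q :: "'a psido"
  assumes "\<And>i. i > N \<Longrightarrow> coef P i = 0" and "\<And>i. i > K \<Longrightarrow> coef Q i = 0"
    and "lo \<le> n - K" and "N \<le> hi" and "N + K - n \<le> int B"
  shows "coef (P * Q) n = (\<Sum>i\<in>{lo..hi}. \<Sum>j\<le>B.
     (real_of_int i gchoose j) *\<^sub>R (coef P i * (ddx ^^ j) (coef Q (n - i + int j))))"
  unfolding times_psido.rep_eq by (rule psido_mult_box) (use assms in auto)

lemma coef_mult_common_box:
  fixes F :: "'a psido set"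
  assumes "finite F"
  shows "\<exists>lo hi B. \<forall>U\<in>F. \<forall>V\<in>F. coef (U * V) n = (\<Sum>i\<in>{lo..hi}. \<Sum>j\<le>B.
    (real_of_int i gchoose j) *\<^sub>R (coef U i * (ddx ^^ j) (coef V (n - i + int j))))"
proof -
  have "\<exists>N. \<forall>U\<in>F. \<forall>i>N. coef U i = 0"
    using assms
  proof (induction F)
    case (insert P F)
    then obtain N where N: "\<forall>U\<in>F. \<forall>i>N. coef U i = 0" by blast
    obtain K where "\<And>i. i > K \<Longrightarrow> coef P i = 0" using coef_bound by metis
    with N show ?case by (intro exI[of _ "max N K"]) auto
  qed simp
  then obtain N where N: "\<And>U i. U \<in> F \<Longrightarrow> i > N \<Longrightarrow> coef U i = 0" by blast
  show ?thesis
    by (rule exI[of _ "n - N"], rule exI[of _ N], rule exI[of _ "nat (N + N - n)"])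
      (auto intro!: coef_mult_box[of N _ N] N)
qed

instance
proof
  fix P Q R :: "'a psido" and r s :: real
  show "P + Q + R = P + (Q + R)" by transfer (simp add: add.assoc)
  show "P + Q = Q + P" by transfer (simp add: add.commute)
  show "0 + P = P" by transfer simp
  show "- P + P = 0" by transfer simp
  show "P - Q = P + - Q" by transfer simp
  show "r *\<^sub>R (P + Q) = r *\<^sub>R P + r *\<^sub>R Q" by transfer (simp add: scaleR_add_right)
  show "(r + s) *\<^sub>R P = r *\<^sub>R P + s *\<^sub>R P" by transfer (simp add: scaleR_add_left)
  show "r *\<^sub>R s *\<^sub>R P = (r * s) *\<^sub>R P" by transfer simp
  show "1 *\<^sub>R P = P" by transfer simp
  show "(0 :: 'a psido) \<noteq> 1" by transfer (auto simp: fun_eq_iff)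
  show "P * Q * R = P * (Q * R)"
    by transfer (auto intro!: ext psido_mult_assoc)
  show "(P + Q) * R = P * R + Q * R"
  proof (rule psido_eqI)
    fix n
    obtain lo hi B where b: "\<forall>U\<in>{P + Q, P, Q, R}. \<forall>V\<in>{P + Q, P, Q, R}.
      coef (U * V) n = (\<Sum>i\<in>{lo..hi}. \<Sum>j\<le>B.
        (real_of_int i gchoose j) *\<^sub>R (coef U i * (ddx ^^ j) (coef V (n - i + int j))))"
      using coef_mult_common_box[of "{P + Q, P, Q, R}" n] by auto
    show "coef ((P + Q) * R) n = coef (P * R + Q * R) n"
      using b
      by (simp add: plus_psido.rep_eq algebra_simps sum.distrib)
  qed
  show "P * (Q + R) = P * Q + P * R"
  proof (rule psido_eqI)
    fix n
    obtain lo hi B where b: "\<forall>U\<in>{P, Q, R, Q + R}. \<forall>V\<in>{P, Q, R, Q + R}.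
      coef (U * V) n = (\<Sum>i\<in>{lo..hi}. \<Sum>j\<le>B.
        (real_of_int i gchoose j) *\<^sub>R (coef U i * (ddx ^^ j) (coef V (n - i + int j))))"
      using coef_mult_common_box[of "{P, Q, R, Q + R}" n] by auto
    show "coef (P * (Q + R)) n = coef (P * Q + P * R) n"
      using b
      by (simp add: plus_psido.rep_eq ddxn_add algebra_simps sum.distrib)
  qed
  show "r *\<^sub>R P * Q = r *\<^sub>R (P * Q)"
  proof (rule psido_eqI)
    fix n
    obtain lo hi B where b: "\<forall>U\<in>{r *\<^sub>R P, P, Q}. \<forall>V\<in>{r *\<^sub>R P, P, Q}.
      coef (U * V) n = (\<Sum>i\<in>{lo..hi}. \<Sum>j\<le>B.
        (real_of_int i gchoose j) *\<^sub>R (coef U i * (ddx ^^ j) (coef V (n - i + int j))))"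
      using coef_mult_common_box[of "{r *\<^sub>R P, P, Q}" n] by auto
    show "coef (r *\<^sub>R P * Q) n = coef (r *\<^sub>R (P * Q)) n"
      using b
      by (simp add: scaleR_psido.rep_eq scaleR_sum_right mult.commute)
  qed
  show "P * r *\<^sub>R Q = r *\<^sub>R (P * Q)"
  proof (rule psido_eqI)
    fix n
    obtain lo hi B where b: "\<forall>U\<in>{P, r *\<^sub>R Q, Q}. \<forall>V\<in>{P, r *\<^sub>R Q, Q}.
      coef (U * V) n = (\<Sum>i\<in>{lo..hi}. \<Sum>j\<le>B.
        (real_of_int i gchoose j) *\<^sub>R (coef U i * (ddx ^^ j) (coef V (n - i + int j))))"
      using coef_mult_common_box[of "{P, r *\<^sub>R Q, Q}" n] by auto
    show "coef (P * r *\<^sub>R Q) n = coef (r *\<^sub>R (P * Q)) n"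
      using b
      by (simp add: scaleR_psido.rep_eq scaleR_sum_right ddxn_scaleR mult.commute)
  qed
  show "1 * P = P"
  proof (rule psido_eqI)
    fix n
    have "coef (1 * P) n = psido_mult (\<lambda>i. if i = 0 then 1 else 0) (coef P) n"
      by (simp add: times_psido.rep_eq one_psido.rep_eq)
    also obtain K where K: "\<And>i. i > K \<Longrightarrow> coef P i = 0" using coef_bound by metis
    have "psido_mult (\<lambda>i. if i = 0 then 1 else 0) (coef P) n =
        (\<Sum>i\<in>{min 0 (n - K)..0}. \<Sum>j\<le>nat (0 + K - n). (real_of_int i gchoose j) *\<^sub>R
          ((if i = 0 then 1 else 0) * (ddx ^^ j) (coef P (n - i + int j))))"
      by (rule psido_mult_box[of 0 _ K]) (use K in auto)
    also have "\<dots> = (\<Sum>i\<in>{min 0 (n - K)..0}. if i = 0 then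
        (\<Sum>j\<le>nat (K - n). (0 gchoose j :: real) *\<^sub>R (ddx ^^ j) (coef P (n + int j))) else 0)"
      by (intro sum.cong refl) auto
    also have "\<dots> = (\<Sum>j\<le>nat (K - n). (0 gchoose j :: real) *\<^sub>R (ddx ^^ j) (coef P (n + int j)))"
      by (subst sum.delta) auto
    also have "\<dots> = (\<Sum>j\<le>nat (K - n). if j = 0 then coef P n else 0)"
      by (intro sum.cong refl) (auto simp: gbinomial_0_left)
    finally show "coef (1 * P) n = coef P n" by simp
  qed
  show "P * 1 = P"
  proof (rule psido_eqI)
    fix n
    have "coef (P * 1) n = psido_mult (coef P) (\<lambda>i. if i = 0 then 1 else 0) n"
      by (simp add: times_psido.rep_eq one_psido.rep_eq)
    also obtain K where K: "\<And>i. i > K \<Longrightarrow> coef P i = 0" using coef_bound by metis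
    have "psido_mult (coef P) (\<lambda>i. if i = 0 then 1 else 0) n =
        (\<Sum>i\<in>{n..max n K}. \<Sum>j\<le>nat (K - n). (real_of_int i gchoose j) *\<^sub>R
          (coef P i * (ddx ^^ j) (if n - i + int j = 0 then 1 else 0)))"
      by (rule psido_mult_box[of K _ 0]) (use K in auto)
    also have "\<dots> = (\<Sum>i\<in>{n..max n K}. \<Sum>j\<le>nat (K - n).
        if j = 0 then (if i = n then coef P n else 0) else 0)"
      by (intro sum.cong refl) (auto simp: ddxn_1)
    finally show "coef (P * 1) n = coef P n" by (simp add: sum.delta)
  qed
qed

end
text \<open>The operator \<open>f \<partial>\<^sup>n\<close>.\<close>

lift_definition psido_monom :: "'a::zero \<Rightarrow> int \<Rightarrow> 'a psido" is "\<lambda>f n i. if i = n then f else 0"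
proof -
  fix f :: 'a and n :: int
  show "\<exists>N. \<forall>i>N. (if i = n then f else 0) = 0" by (intro exI[of _ n]) auto
qed

lift_definition psido_neg :: "'a::zero psido \<Rightarrow> 'a psido" is "\<lambda>f i. if i < 0 then f i else 0"
  by (auto intro!: exI[of _ 0])

text \<open>Differentiation of the coefficients (not the product with \<open>\<partial>\<close>).\<close>

lift_definition psido_ddx :: "'a::function_algebra psido \<Rightarrow> 'a psido" is "\<lambda>f i. ddx (f i)"
  by (metis ddx_0)


section \<open>Power series in the times\<close>

text \<open>
  The time \<open>t\<^sub>1 = x\<close> is part of the function algebra; everything depends on the higher times and on \<open>log q\<close> as a
  formal power series; a monomial is the multiset of its factors. \<open>Time n\<close> is the time \<open>t\<^sub>n\<close>
  for odd \<open>n \<ge> 3\<close>; no equation below involves \<open>Time n\<close> for other \<open>n\<close>, so that those are mere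
  spectator parameters.
\<close>

datatype param = LogQ | Time nat

typedef 'b series = "UNIV :: (param multiset \<Rightarrow> 'b) set"
  morphisms nth Series by simp

setup_lifting type_definition_series

lemma series_eqI: "(\<And>c. nth f c = nth g c) \<Longrightarrow> f = g"
  by (simp add: nth_inject[symmetric] fun_eq_iff)

lemma finite_submultisets: "finite {b. b \<subseteq># (c :: 'v multiset)}"
proof (induction c)
  case (add v c)
  have "{b. b \<subseteq># add_mset v c} \<subseteq> {b. b \<subseteq># c} \<union> add_mset v ` {b. b \<subseteq># c}"
  proof
    fix b assume "b \<in> {b. b \<subseteq># add_mset v c}"
    then have b: "b \<subseteq># add_mset v c" by simp
    show "b \<in> {b. b \<subseteq># c} \<union> add_mset v ` {b. b \<subseteq># c}"
    proof (cases "v \<in># b")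
      case True
      then obtain b' where "b = add_mset v b'" by (meson mset_add)
      with b show ?thesis by auto
    next
      case False
      have "b \<subseteq># c"
      proof (rule mset_subset_eqI)
        fix w
        show "count b w \<le> count c w"
          using mset_subset_eq_count[OF b, of w] False
          by (cases "w = v") (simp_all add: not_in_iff)
      qed
      then show ?thesis by simp
    qed
  qed
  then show ?case using add by (meson finite_UnI finite_imageI finite_subset)
qed simp

instantiation series :: (real_algebra_1) real_algebra_1
begin

lift_definition zero_series :: "'a series" is "\<lambda>_. 0" .
lift_definition one_series :: "'a series" is "\<lambda>c. if c = {#} then 1 else 0" .
lift_definition plus_series :: "'a series \<Rightarrow> 'a series \<Rightarrow> 'a series" is "\<lambda>f g c. f c + g c" .
lift_definition minus_series :: "'a series \<Rightarrow> 'a series \<Rightarrow> 'a series" is "\<lambda>f g c. f c - g c" .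
lift_definition uminus_series :: "'a series \<Rightarrow> 'a series" is "\<lambda>f c. - f c" .
lift_definition scaleR_series :: "real \<Rightarrow> 'a series \<Rightarrow> 'a series" is "\<lambda>r f c. r *\<^sub>R f c" .
lift_definition times_series :: "'a series \<Rightarrow> 'a series \<Rightarrow> 'a series" is
  "\<lambda>f g c. \<Sum>b | b \<subseteq># c. f b * g (c - b)" .

instance
proof
  fix f g h :: "'a series" and r s :: real
  show "f + g + h = f + (g + h)" by transfer (simp add: add.assoc)
  show "f + g = g + f" by transfer (simp add: add.commute)
  show "0 + f = f" by transfer simp
  show "- f + f = 0" by transfer simp
  show "f - g = f + - g" by transfer simp
  show "r *\<^sub>R (f + g) = r *\<^sub>R f + r *\<^sub>R g" by transfer (simp add: scaleR_add_right)
  show "(r + s) *\<^sub>R f = r *\<^sub>R f + s *\<^sub>R f" by transfer (simp add: scaleR_add_left)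
  show "r *\<^sub>R s *\<^sub>R f = (r * s) *\<^sub>R f" by transfer simp
  show "1 *\<^sub>R f = f" by transfer simp
  show "(0 :: 'a series) \<noteq> 1" by transfer (auto simp: fun_eq_iff)
  show "(f + g) * h = f * h + g * h" by transfer (simp add: distrib_right sum.distrib)
  show "f * (g + h) = f * g + f * h" by transfer (simp add: distrib_left sum.distrib)
  show "r *\<^sub>R f * g = r *\<^sub>R (f * g)" by transfer (simp add: scaleR_sum_right)
  show "f * r *\<^sub>R g = r *\<^sub>R (f * g)" by transfer (simp add: scaleR_sum_right)
  show "1 * f = f"
  proof (transfer, rule ext)
    fix f :: "param multiset \<Rightarrow> 'a" and c
    have "(\<Sum>b | b \<subseteq># c. (if b = {#} then 1 else 0) * f (c - b)) =
        (\<Sum>b | b \<subseteq># c. if b = {#} then f c else 0)"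
      by (intro sum.cong refl) auto
    then show "(\<Sum>b | b \<subseteq># c. (if b = {#} then 1 else 0) * f (c - b)) = f c"
      by (simp add: sum.delta finite_submultisets)
  qed
  show "f * 1 = f"
  proof (transfer, rule ext)
    fix f :: "param multiset \<Rightarrow> 'a" and c
    have "(\<Sum>b | b \<subseteq># c. f b * (if c - b = {#} then 1 else 0)) =
        (\<Sum>b | b \<subseteq># c. if b = c then f c else 0)"
      by (intro sum.cong refl) (auto simp: Diff_eq_empty_iff_mset dest: subset_mset.antisym)
    then show "(\<Sum>b | b \<subseteq># c. f b * (if c - b = {#} then 1 else 0)) = f c"
      by (simp add: sum.delta finite_submultisets)
  qed
  show "f * g * h = f * (g * h)"
  proof (transfer, rule ext)
    fix f g h :: "param multiset \<Rightarrow> 'a" and c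
    have "(\<Sum>a | a \<subseteq># c. (\<Sum>b | b \<subseteq># a. f b * g (a - b)) * h (c - a)) =
        (\<Sum>(a, b)\<in>(SIGMA a:{a. a \<subseteq># c}. {b. b \<subseteq># a}). f b * g (a - b) * h (c - a))"
      by (subst sum.Sigma[symmetric]) (auto simp: sum_distrib_right finite_submultisets)
    also have "\<dots> = (\<Sum>(b, d)\<in>(SIGMA b:{b. b \<subseteq># c}. {d. d \<subseteq># c - b}). f b * (g d * h (c - b - d)))"
    proof (rule sum.reindex_bij_witness[of _ "\<lambda>(b, d). (b + d, b)" "\<lambda>(a, b). (b, a - b)"])
      fix u assume "u \<in> (SIGMA a:{a. a \<subseteq># c}. {b. b \<subseteq># a})"
      then show "(case case u of (a, b) \<Rightarrow> (b, a - b) of (b, d) \<Rightarrow> f b * (g d * h (c - b - d))) =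
          (case u of (a, b) \<Rightarrow> f b * g (a - b) * h (c - a))"
        by (auto simp: mult.assoc diff_diff_add_mset subset_mset.add_diff_inverse)
    qed (auto simp: subset_mset.le_diff_conv2 subset_mset.add_diff_inverse add.commute
        intro: subset_mset.order_trans)
    also have "\<dots> = (\<Sum>b | b \<subseteq># c. f b * (\<Sum>d | d \<subseteq># c - b. g d * h (c - b - d)))"
      by (subst sum.Sigma[symmetric]) (auto simp: sum_distrib_left finite_submultisets)
    finally show "(\<Sum>a | a \<subseteq># c. (\<Sum>b | b \<subseteq># a. f b * g (a - b)) * h (c - a)) =
        (\<Sum>b | b \<subseteq># c. f b * (\<Sum>d | d \<subseteq># c - b. g d * h (c - b - d)))" .
  qed
qed

end

definition series_const :: "'b::zero \<Rightarrow> 'b series" where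
  "series_const b = Series (\<lambda>c. if c = {#} then b else 0)"

definition series_map :: "('b \<Rightarrow> 'c) \<Rightarrow> 'b series \<Rightarrow> 'c series" where
  "series_map h f = Series (\<lambda>c. h (nth f c))"

definition log_q :: "'b::zero_neq_one series" where
  "log_q = Series (\<lambda>c. if c = {#LogQ#} then 1 else 0)"


section \<open>The KdV hierarchy and its additional flows\<close>

text \<open>
  Operators whose coefficients are series in the times. As \<open>\<partial>\<close> commutes with the higher times, these
  are the series in the times whose coefficients are operators in \<open>x\<close>. Every coefficient has finite
  order, but the order may grow with the monomial, as it does for \<open>gamma_kdv\<close>.
\<close>

type_synonym 'a oper = "'a psido series"

definition D_pow :: "int \<Rightarrow> 'a::function_algebra oper" where
  "D_pow n = series_const (psido_monom 1 n)"

definition neg_part :: "'a::function_algebra oper \<Rightarrow> 'a oper" where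
  "neg_part = series_map psido_neg"

definition time_deriv :: "nat \<Rightarrow> 'a::function_algebra oper \<Rightarrow> 'a oper" where
  "time_deriv n P =
     (if n = 1 then series_map psido_ddx P
      else Series (\<lambda>c. real (count c (Time n) + 1) *\<^sub>R nth P (add_mset (Time n) c)))"

text \<open>The two-sided inverse, which exists for \<open>1 + (negative part)\<close> by the geometric series.\<close>

definition oper_inverse :: "'a::function_algebra oper \<Rightarrow> 'a oper" where
  "oper_inverse S = (THE T. S * T = 1 \<and> T * S = 1)"

definition dressing :: "'a::function_algebra oper \<Rightarrow> bool" where
  "dressing S \<longleftrightarrow> S = 1 + neg_part S"

definition lax :: "'a::function_algebra oper \<Rightarrow> 'a oper" where
  "lax S = S * D_pow 2 * oper_inverse S"

definition lax_half_pow :: "'a::function_algebra oper \<Rightarrow> nat \<Rightarrow> 'a oper" where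
  "lax_half_pow S n = S * D_pow (int n) * oper_inverse S"

definition kdv_flow :: "nat \<Rightarrow> 'a::function_algebra oper \<Rightarrow> 'a oper" where
  "kdv_flow n S = - neg_part (lax_half_pow S n) * S"

definition kdv_solution :: "'a::function_algebra oper \<Rightarrow> bool" where
  "kdv_solution S \<longleftrightarrow> dressing S \<and>
     (\<exists>u :: 'a series. lax S = D_pow 2 + series_map (\<lambda>f. psido_monom f 0) u) \<and>
     (\<forall>n. odd n \<longrightarrow> time_deriv n S = kdv_flow n S)"

text \<open>
  \<open>\<Gamma> = \<onehalf> \<Sum> i t\<^sub>i \<partial>\<^bsup>i-2\<^esup>\<close> over odd \<open>i \<ge> 1\<close>: the term \<open>i = 1\<close> sits at the empty monomial because \<open>t\<^sub>1 = x\<close>.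
\<close>

definition gamma_kdv :: "'a::function_algebra oper" where
  "gamma_kdv = Series (\<lambda>c.
     if c = {#} then psido_monom ((1/2) *\<^sub>R xvar) (-1)
     else if \<exists>i. odd i \<and> i \<ge> 3 \<and> c = {#Time i#}
       then (let i = (THE i. c = {#Time i#}) in psido_monom ((real i / 2) *\<^sub>R 1) (int i - 2))
     else 0)"

definition orlov_shulman :: "'a::function_algebra oper \<Rightarrow> 'a oper" where
  "orlov_shulman S = S * gamma_kdv * oper_inverse S"

definition exp_M_q_L_term ::
  "nat \<Rightarrow> nat \<Rightarrow> 'a::function_algebra oper \<Rightarrow> nat \<Rightarrow> nat \<Rightarrow> 'a oper" where
  "exp_M_q_L_term m n S p s =
     (real m ^ p / (fact p * fact s)) *\<^sub>R (orlov_shulman S ^ p * lax S ^ s * (real n *\<^sub>R log_q) ^ s)"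

text \<open>
  For a dressing operator \<open>S\<close> the double series converges coefficientwise: at a fixed monomial \<open>c\<close>
  only \<open>s \<le> count c LogQ\<close> contribute, and since the constant term of \<open>M\<close> has order \<open>-1\<close> while all but
  at most \<open>size c\<close> of the \<open>p\<close> factors \<open>M\<close> contribute their constant term, the order of the \<open>p\<close>-th term
  at \<open>c\<close> tends to \<open>-\<infinity>\<close>. So each coefficient is a sum with finitely many nonzero terms, and the
  orders at \<open>c\<close> are bounded.
\<close>

definition exp_M_q_L :: "nat \<Rightarrow> nat \<Rightarrow> 'a::function_algebra oper \<Rightarrow> 'a oper" where
  "exp_M_q_L m n S = Series (\<lambda>c. Psido (\<lambda>i.
     \<Sum>(p, s) | coef (nth (exp_M_q_L_term m n S p s) c) i \<noteq> 0.
       coef (nth (exp_M_q_L_term m n S p s) c) i))"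

definition additional_flow :: "nat \<Rightarrow> nat \<Rightarrow> 'a::function_algebra oper \<Rightarrow> 'a oper" where
  "additional_flow m n S = - neg_part (exp_M_q_L m n S) * S"

text \<open>
  A flow \<open>\<partial>S = X S\<close> acts on a functional \<open>F\<close> of the dressing operator through
  \<open>\<partial>(F S) = d/dr F (S + r X S)\<close> at \<open>r = 0\<close>. Each coefficient of \<open>F (S + r X S)\<close> is required to be a
  polynomial in the real number \<open>r\<close>, whose linear coefficient is the derivative; no topology on the
  function algebra is needed, and the derivative \<open>W\<close> is unique.
\<close>

definition has_flow_derivative ::
  "('a::function_algebra oper \<Rightarrow> 'a oper) \<Rightarrow> 'a oper \<Rightarrow> ('a oper \<Rightarrow> 'a oper) \<Rightarrow> 'a oper \<Rightarrow> bool" where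
  "has_flow_derivative F W X S \<longleftrightarrow>
     (\<forall>c i. \<exists>p :: 'a poly.
        (\<forall>r::real. coef (nth (F (S + r *\<^sub>R X S)) c) i = poly p (of_real r)) \<and>
        poly.coeff p 1 = coef (nth W c) i)"

text \<open>
  The flows \<open>\<partial>S = X S\<close> and \<open>\<partial>\<^bsub>t\<^sub>n\<^esub>\<close> commute at a solution \<open>S\<close> of the hierarchy:
  \<open>\<partial>(\<partial>\<^bsub>t\<^sub>n\<^esub> S) = \<partial>\<^bsub>t\<^sub>n\<^esub>(\<partial>S)\<close>. On the left \<open>\<partial>\<close> acts on \<open>\<partial>\<^bsub>t\<^sub>n\<^esub> S = kdv_flow n S\<close>, which is a functional
  of \<open>S\<close>; on the right \<open>\<partial>\<^bsub>t\<^sub>n\<^esub>\<close> is the time derivative of the function \<open>X S\<close>, which accounts both for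
  the evolution of \<open>S\<close> and for the times occurring explicitly in \<open>X\<close>.
  The formula for \<open>kdv_flow n\<close> is also applied to \<open>S + r X S\<close>, for which \<open>lax\<close> need not be a
  differential operator: the additional flows do not preserve the form \<open>\<partial>\<^sup>2 + u\<close> in general.
\<close>

definition commutes_with_kdv_flow ::
  "('a::function_algebra oper \<Rightarrow> 'a oper) \<Rightarrow> nat \<Rightarrow> 'a oper \<Rightarrow> bool" where
  "commutes_with_kdv_flow X n S \<longleftrightarrow> has_flow_derivative (kdv_flow n) (time_deriv n (X S)) X S"

end

theory Submission
  imports Defs
begin

text \<open>
  Write \<open>L\<^sup>n\<^sup>/\<^sup>2 = B = B\<^sub>+ + B\<^sub>-\<close> and let \<open>E\<close> be the exponential. Since \<open>\<partial>\<^sub>n - \<partial>\<^sup>n\<close> commutes with \<open>\<Gamma>\<close> and with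
  \<open>\<partial>\<^sup>2\<close>, dressing gives \<open>\<partial>\<^sub>n M = [B\<^sub>+, M]\<close> and \<open>\<partial>\<^sub>n L = [B\<^sub>+, L]\<close>, hence \<open>\<partial>\<^sub>n E = [B\<^sub>+, E]\<close> by
  continuity of the derivation \<open>\<partial>\<^sub>n - [B\<^sub>+, \<sqdot>]\<close>. The additional flow moves \<open>B\<close> by \<open>[B, E\<^sub>-]\<close>, and the two
  mixed derivatives of \<open>S\<close> agree because
  \<open>[E\<^sub>-, B]\<^sub>- + B\<^sub>- E\<^sub>- = E\<^sub>- B\<^sub>- - [B\<^sub>+, E]\<^sub>-\<close>.
\<close>

section \<open>Coefficients\<close>

lemmas series_simps [simp] = zero_series.rep_eq plus_series.rep_eq minus_series.rep_eq
  uminus_series.rep_eq scaleR_series.rep_eq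

lemmas psido_simps [simp] = zero_psido.rep_eq plus_psido.rep_eq minus_psido.rep_eq
  uminus_psido.rep_eq scaleR_psido.rep_eq psido_monom.rep_eq psido_neg.rep_eq psido_ddx.rep_eq

lemma nth_Series [simp]: "nth (Series f) = f"
  by (simp add: Series_inverse)

lemma nth_series_map [simp]: "nth (series_map h f) c = h (nth f c)"
  by (simp add: series_map_def)

lemma nth_sum [simp]: "nth (sum f A) c = (\<Sum>k\<in>A. nth (f k) c)"
  by (induction A rule: infinite_finite_induct) auto

lemma coef_sum [simp]: "coef (sum f A) i = (\<Sum>k\<in>A. coef (f k) i)"
  by (induction A rule: infinite_finite_induct) auto

lemma ddx_sum: "ddx (sum f A) = (\<Sum>i\<in>A. ddx (f i :: 'a::function_algebra))"
  using ddxn_sum[of 1 f A] by simp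

section \<open>Products of operators in x\<close>

lemma coef_mult_eq_0:
  assumes "\<And>i. i > N \<Longrightarrow> coef P i = 0" "\<And>i. i > K \<Longrightarrow> coef Q i = 0" "n > N + K"
  shows "coef (P * Q) n = 0"
  unfolding times_psido.rep_eq by (rule psido_mult_eq_0) (use assms in auto)

text \<open>In the double sum for the coefficient of \<partial>^k, only the pair i = m, j = m + n -
  k survives, and it exists exactly when k \<le> m + n.\<close>

lemma coef_monom_mult_monom:
  fixes f g :: "'a::function_algebra"
  shows "coef (psido_monom f m * psido_monom g n) k =
    (if k \<le> m + n
     then (real_of_int m gchoose nat (m + n - k)) *\<^sub>R (f * (ddx ^^ nat (m + n - k)) g) else 0)"
proof -
  have "coef (psido_monom f m * psido_monom g n) k =
     (\<Sum>(i, j)\<in>(if k \<le> m + n then {(m, nat (m + n - k))} else {}).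
       (real_of_int i gchoose j) *\<^sub>R
         (coef (psido_monom f m) i * (ddx ^^ j) (coef (psido_monom g n) (k - i + int j))))"
    unfolding times_psido.rep_eq psido_mult_def
    by (rule sum.mono_neutral_left) (auto split: if_splits)
  then show ?thesis by simp
qed

lemma psido_ddx_mult: "psido_ddx (P * Q) = psido_ddx P * Q + P * psido_ddx Q"
proof (rule psido_eqI)
  fix n
  \<comment> \<open>One finite box serves all the products involved, so the Leibniz rule for
    \<open>ddx\<close> can be applied term by term to sums over the same index set.\<close>
  obtain lo hi B where b: "\<forall>U\<in>{P, Q, psido_ddx P, psido_ddx Q}. \<forall>V\<in>{P, Q, psido_ddx P, psido_ddx Q}.
      coef (U * V) n = (\<Sum>i\<in>{lo..hi}. \<Sum>j\<le>B.
        (real_of_int i gchoose j) *\<^sub>R (coef U i * (ddx ^^ j) (coef V (n - i + int j))))"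
    using coef_mult_common_box[of "{P, Q, psido_ddx P, psido_ddx Q}" n] by auto
  have "ddx ((ddx ^^ j) a) = (ddx ^^ j) (ddx a)" for j and a :: 'a
    by (simp add: funpow_swap1)
  then show "coef (psido_ddx (P * Q)) n = coef (psido_ddx P * Q + P * psido_ddx Q) n"
    using b by (simp add: ddx_sum ddx_scaleR ddx_mult sum.distrib scaleR_add_right)
qed

text \<open>Differential operators are closed under products: reaching a negative power from
  \<partial>^i with i \<ge> 0 and a nonnegative power in Q takes j > i derivatives, and then the
  binomial coefficient is 0.\<close>

lemma coef_mult_differential:
  assumes "\<And>i. i < 0 \<Longrightarrow> coef P i = 0" "\<And>i. i < 0 \<Longrightarrow> coef Q i = 0" "n < 0"
  shows "coef (P * Q) n = 0"
proof -
  have "(real_of_int i gchoose j) *\<^sub>R (coef P i * (ddx ^^ j) (coef Q (n - i + int j))) = 0" for i j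
  proof (cases "i < 0 \<or> n - i + int j < 0")
    case True
    then show ?thesis using assms by auto
  next
    case False
    then obtain a where a: "i = int a" by (meson not_less nonneg_int_cases)
    then have "a < j" using False assms(3) by linarith
    then have "real_of_int i gchoose j = 0"
      using a by (simp flip: binomial_gbinomial)
    then show ?thesis by simp
  qed
  then show ?thesis
    unfolding times_psido.rep_eq psido_mult_def by (intro sum.neutral) auto
qed

section \<open>Products of series in the times\<close>

lemma nth_mult: "nth (P * Q) c = (\<Sum>b | b \<subseteq># c. nth P b * nth Q (c - b))"
  by (simp add: times_series.rep_eq)

lemma series_const_mult_nth: "nth (series_const p * P) c = p * nth (P :: 'a::real_algebra_1 series) c"
proof -
  have "nth (series_const p * P) c = (\<Sum>b\<in>{{#}}. nth (series_const p) b * nth P (c - b))"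
    unfolding nth_mult series_const_def by (rule sum.mono_neutral_right) (auto simp: finite_submultisets)
  then show ?thesis by (simp add: series_const_def)
qed

lemma mult_series_const_nth: "nth (P * series_const p) c = nth (P :: 'a::real_algebra_1 series) c * p"
proof -
  have "nth (P * series_const p) c = (\<Sum>b\<in>{c}. nth P b * nth (series_const p) (c - b))"
    unfolding nth_mult series_const_def
    by (rule sum.mono_neutral_right)
      (auto simp: finite_submultisets Diff_eq_empty_iff_mset dest: subset_mset.antisym)
  then show ?thesis by (simp add: series_const_def)
qed

text \<open>Multiplication by log q shifts the monomials by one \<open>LogQ\<close>. Left and right
  products are computed separately because the coefficients do not commute; that both agree makes
  log q central.\<close>

lemma log_q_mult_nth:
  "nth (log_q * P) c = (if LogQ \<in># c then nth (P :: 'a::real_algebra_1 series) (c - {#LogQ#}) else 0)"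
proof -
  have "nth (log_q * P) c = (\<Sum>b\<in>(if LogQ \<in># c then {{#LogQ#}} else {}). nth log_q b * nth P (c - b))"
    unfolding nth_mult log_q_def by (rule sum.mono_neutral_right) (auto simp: finite_submultisets)
  then show ?thesis by (simp add: log_q_def)
qed

lemma mult_log_q_nth:
  "nth (P * log_q) c = (if LogQ \<in># c then nth (P :: 'a::real_algebra_1 series) (c - {#LogQ#}) else 0)"
proof -
  have "nth (P * log_q) c =
      (\<Sum>b\<in>(if LogQ \<in># c then {c - {#LogQ#}} else {}). nth P b * nth log_q (c - b))"
    unfolding nth_mult log_q_def
  proof (rule sum.mono_neutral_right)
    show "\<forall>b\<in>{b. b \<subseteq># c} - (if LogQ \<in># c then {c - {#LogQ#}} else {}).
      nth P b * nth (Series (\<lambda>c. if c = {#LogQ#} then 1 else 0)) (c - b) = 0"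
    proof
      fix b assume b: "b \<in> {b. b \<subseteq># c} - (if LogQ \<in># c then {c - {#LogQ#}} else {})"
      have "c - b \<noteq> {#LogQ#}"
      proof
        assume "c - b = {#LogQ#}"
        then have "c = b + {#LogQ#}" using b by (metis DiffD1 mem_Collect_eq subset_mset.add_diff_inverse)
        then show False using b by auto
      qed
      then show "nth P b * nth (Series (\<lambda>c. if c = {#LogQ#} then 1 else 0)) (c - b) = 0" by simp
    qed
  qed (auto simp: finite_submultisets)
  moreover have "c - (c - {#LogQ#}) = {#LogQ#}" if "LogQ \<in># c"
    using that by (auto dest!: multi_member_split)
  ultimately show ?thesis by (simp add: log_q_def)
qed

lemma log_q_commute: "log_q * P = (P :: 'a::real_algebra_1 series) * log_q"
  by (rule series_eqI) (simp only: log_q_mult_nth mult_log_q_nth)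

section \<open>The time derivatives\<close>

lemma time_deriv_add: "time_deriv n (P + Q) = time_deriv n P + time_deriv n Q"
  by (intro series_eqI psido_eqI) (auto simp: time_deriv_def ddx_add scaleR_add_right)

lemma time_deriv_scaleR: "time_deriv n (r *\<^sub>R P) = r *\<^sub>R time_deriv n P"
  by (intro series_eqI psido_eqI) (auto simp: time_deriv_def ddx_scaleR)

text \<open>The Leibniz rule for the partial derivative in the variable v. The weight is the
  exponent of v in v c, which is the exponent in b plus the exponent in the complement of b; this
  splits the product sum in two.\<close>

lemma partial_deriv_mult:
  fixes P Q :: "'b::real_algebra_1 series"
  shows "real (count c v + 1) *\<^sub>R nth (P * Q) (add_mset v c) =
    (\<Sum>b | b \<subseteq># c. (real (count b v + 1) *\<^sub>R nth P (add_mset v b)) * nth Q (c - b)) +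
    (\<Sum>b | b \<subseteq># c. nth P b * (real (count (c - b) v + 1) *\<^sub>R nth Q (add_mset v (c - b))))"
proof -
  let ?c = "add_mset v c"
  have "real (count c v + 1) *\<^sub>R nth (P * Q) ?c =
     (\<Sum>b | b \<subseteq># ?c. real (count b v) *\<^sub>R (nth P b * nth Q (?c - b))
        + real (count (?c - b) v) *\<^sub>R (nth P b * nth Q (?c - b)))"
    unfolding nth_mult scaleR_sum_right
  proof (rule sum.cong[OF refl])
    fix b assume "b \<in> {b. b \<subseteq># ?c}"
    then have "count b v \<le> count ?c v" by (simp only: mem_Collect_eq mset_subset_eq_count)
    then have "count c v + 1 = count b v + count (?c - b) v" by simp
    then have "real (count c v + 1) = real (count b v) + real (count (?c - b) v)"
      by (metis of_nat_add)
    then show "real (count c v + 1) *\<^sub>R (nth P b * nth Q (?c - b)) =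
      real (count b v) *\<^sub>R (nth P b * nth Q (?c - b)) + real (count (?c - b) v) *\<^sub>R (nth P b * nth Q (?c - b))"
      by (simp only: scaleR_add_left)
  qed
  also have "\<dots> = (\<Sum>b | b \<subseteq># ?c. real (count b v) *\<^sub>R (nth P b * nth Q (?c - b)))
      + (\<Sum>b | b \<subseteq># ?c. real (count (?c - b) v) *\<^sub>R (nth P b * nth Q (?c - b)))"
    by (rule sum.distrib)
  \<comment> \<open>The weight vanishes unless v divides b, so b runs over the multiples by v of the
    divisors of c.\<close>
  also have "(\<Sum>b | b \<subseteq># ?c. real (count b v) *\<^sub>R (nth P b * nth Q (?c - b))) =
     (\<Sum>b\<in>add_mset v ` {b. b \<subseteq># c}. real (count b v) *\<^sub>R (nth P b * nth Q (?c - b)))"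
  proof (rule sum.mono_neutral_right)
    show "\<forall>b\<in>{b. b \<subseteq># ?c} - add_mset v ` {b. b \<subseteq># c}.
        real (count b v) *\<^sub>R (nth P b * nth Q (?c - b)) = 0"
    proof
      fix b assume b: "b \<in> {b. b \<subseteq># ?c} - add_mset v ` {b. b \<subseteq># c}"
      have "v \<notin># b"
      proof
        assume "v \<in># b"
        then obtain b' where "b = add_mset v b'" by (meson mset_add)
        with b show False by auto
      qed
      then show "real (count b v) *\<^sub>R (nth P b * nth Q (?c - b)) = 0" by (simp add: not_in_iff)
    qed
  qed (auto simp: finite_submultisets)
  also have "\<dots> = (\<Sum>b | b \<subseteq># c. (real (count b v + 1) *\<^sub>R nth P (add_mset v b)) * nth Q (c - b))"
    by (subst sum.reindex) (auto simp: inj_on_def)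
  \<comment> \<open>The weight vanishes unless v divides the complement, that is, unless b already
    divides c.\<close>
  also have "(\<Sum>b | b \<subseteq># ?c. real (count (?c - b) v) *\<^sub>R (nth P b * nth Q (?c - b))) =
     (\<Sum>b | b \<subseteq># c. real (count (?c - b) v) *\<^sub>R (nth P b * nth Q (?c - b)))"
  proof (rule sum.mono_neutral_right)
    show "\<forall>b\<in>{b. b \<subseteq># ?c} - {b. b \<subseteq># c}. real (count (?c - b) v) *\<^sub>R (nth P b * nth Q (?c - b)) = 0"
    proof
      fix b assume b: "b \<in> {b. b \<subseteq># ?c} - {b. b \<subseteq># c}"
      then have "?c = b + (?c - b)" by (auto simp: subset_mset.add_diff_inverse)
      have "v \<notin># ?c - b"
      proof
        assume "v \<in># ?c - b"
        then obtain d where "?c - b = add_mset v d" by (meson mset_add)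
        with \<open>?c = b + (?c - b)\<close> have "c = b + d" by simp
        with b show False by auto
      qed
      then show "real (count (?c - b) v) *\<^sub>R (nth P b * nth Q (?c - b)) = 0" by (simp add: not_in_iff)
    qed
    show "{b. b \<subseteq># c} \<subseteq> {b. b \<subseteq># ?c}" by (auto intro: subset_mset.order_trans)
  qed (auto simp: finite_submultisets)
  also have "\<dots> = (\<Sum>b | b \<subseteq># c. nth P b * (real (count (c - b) v + 1) *\<^sub>R nth Q (add_mset v (c - b))))"
  proof (rule sum.cong[OF refl])
    fix b assume "b \<in> {b. b \<subseteq># c}"
    then have "?c - b = add_mset v (c - b)"
      by (auto simp: mset_subset_eq_exists_conv)
    then show "real (count (?c - b) v) *\<^sub>R (nth P b * nth Q (?c - b)) =
      nth P b * (real (count (c - b) v + 1) *\<^sub>R nth Q (add_mset v (c - b)))" by simp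
  qed
  finally show ?thesis .
qed

lemma time_deriv_mult: "time_deriv n (P * Q) = time_deriv n P * Q + P * time_deriv n Q"
proof (rule series_eqI)
  fix c
  have add: "psido_ddx (sum f A) = (\<Sum>k\<in>A. psido_ddx (f k))" for f :: "'b \<Rightarrow> 'a psido" and A
    by (rule psido_eqI) (simp add: ddx_sum)
  show "nth (time_deriv n (P * Q)) c = nth (time_deriv n P * Q + P * time_deriv n Q) c"
  proof (cases "n = 1")
    case True
    then show ?thesis
      by (simp add: time_deriv_def nth_mult add psido_ddx_mult sum.distrib)
  next
    case False
    then show ?thesis
      using partial_deriv_mult[of c "Time n" P Q] by (simp add: time_deriv_def nth_mult)
  qed
qed

lemma time_deriv_series_const:
  assumes "psido_ddx p = 0"
  shows "time_deriv n (series_const p) = 0"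
  by (rule series_eqI) (use assms in \<open>auto simp: time_deriv_def series_const_def intro!: psido_eqI\<close>)

lemma time_deriv_D_pow: "time_deriv n (D_pow m) = 0"
  unfolding D_pow_def by (rule time_deriv_series_const) (auto intro!: psido_eqI)

lemma one_series_eq: "1 = series_const 1"
  by (rule series_eqI) (simp add: series_const_def one_series.rep_eq)

lemma time_deriv_one: "time_deriv n 1 = 0"
  unfolding one_series_eq by (rule time_deriv_series_const) (auto intro!: psido_eqI simp: one_psido.rep_eq)

lemma time_deriv_log_q: "time_deriv n (log_q :: 'a::function_algebra oper) = 0"
  by (intro series_eqI psido_eqI) (auto simp: time_deriv_def log_q_def one_psido.rep_eq)

section \<open>Commutators with powers of \<partial> and the explicit times in \<Gamma>\<close>

lemma D_pow_mult: "D_pow m * D_pow n = D_pow (m + n)"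
proof (rule series_eqI)
  fix c
  have "psido_monom 1 m * psido_monom 1 n = (psido_monom 1 (m + n) :: 'a psido)"
    by (rule psido_eqI) (auto simp: coef_monom_mult_monom ddxn_1)
  then show "nth (D_pow m * D_pow n) c = nth (D_pow (m + n) :: 'a oper) c"
    unfolding D_pow_def series_const_mult_nth by (simp add: series_const_def)
qed

text \<open>The expansion of \<partial>^n composed with f stops after the first derivative, and its
  leading term cancels in the commutator.\<close>

lemma monom_commutator:
  fixes f :: "'a::function_algebra"
  assumes "ddx (ddx f) = 0"
  shows "psido_monom 1 n * psido_monom f m - psido_monom f m * psido_monom 1 n =
    psido_monom (real_of_int n *\<^sub>R ddx f) (m + n - 1)"
proof (rule psido_eqI)
  fix k
  have "(ddx ^^ j) f = (if j = 0 then f else if j = 1 then ddx f else 0)" for j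
  proof (cases "j \<le> 1")
    case False
    then obtain k where "j = Suc (Suc k)" by (metis Suc_le_D not_less_eq_eq One_nat_def)
    then show ?thesis using assms by (simp add: funpow_swap1)
  qed (cases j; simp)
  then show "coef (psido_monom 1 n * psido_monom f m - psido_monom f m * psido_monom 1 n) k =
    coef (psido_monom (real_of_int n *\<^sub>R ddx f) (m + n - 1)) k"
    by (auto simp: coef_monom_mult_monom ddxn_1 nat_eq_iff)
qed

text \<open>Both sides equal (n/2) \<partial>^(n-2). On the right only the term in x fails to
  commute with \<partial>^n, since the coefficients at the higher times are constant; on the left
  the derivative picks out the coefficient of t_n.\<close>

lemma time_deriv_gamma_kdv:
  assumes "odd n"
  shows "time_deriv n gamma_kdv = D_pow (int n) * gamma_kdv - gamma_kdv * D_pow (int n)"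
proof (rule series_eqI)
  fix c
  have dr: "ddx (r *\<^sub>R 1) = (0::'a)" for r by (simp add: ddx_scaleR)
  have z: "psido_monom 0 i = (0 :: 'a psido)" for i by (rule psido_eqI) simp
  have dz: "psido_ddx (psido_monom (r *\<^sub>R 1) i) = (0 :: 'a psido)" for r i by (rule psido_eqI) (simp add: dr)
  have dz0: "psido_ddx 0 = (0 :: 'a psido)" by (rule psido_eqI) simp
  have "n \<ge> 1" using assms by (cases n) auto
  have "nth (D_pow (int n) * gamma_kdv - gamma_kdv * D_pow (int n) :: 'a oper) c =
     psido_monom 1 n * nth gamma_kdv c - nth gamma_kdv c * psido_monom 1 n"
    by (simp add: D_pow_def series_const_mult_nth mult_series_const_nth)
  also have "\<dots> = (if c = {#} then psido_monom ((real n / 2) *\<^sub>R 1) (int n - 2) else 0)"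
    by (auto simp: gamma_kdv_def monom_commutator ddx_scaleR ddx_xvar dr z Let_def simp del: right_minus_eq)
  also have "\<dots> = nth (time_deriv n gamma_kdv) c"
  proof (cases "n = 1")
    case True
    then show ?thesis
      by (auto simp: time_deriv_def gamma_kdv_def dz dz0 ddx_scaleR ddx_xvar intro!: psido_eqI)
  next
    case False
    then have "n \<ge> 3" using assms \<open>n \<ge> 1\<close> by presburger
    show ?thesis
    proof (cases "c = {#}")
      case True
      \<comment> \<open>The description in \<open>gamma_kdv\<close> reduces to this one at the
        monomial \<open>{#Time n#}\<close>.\<close>
      have "(THE i. n = i) = n" by blast
      then show ?thesis using True \<open>n \<noteq> 1\<close> \<open>n \<ge> 3\<close> assms by (simp add: time_deriv_def gamma_kdv_def)
    next
      case False
      then show ?thesis using \<open>n \<noteq> 1\<close> by (auto simp: time_deriv_def gamma_kdv_def)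
    qed
  qed
  finally show "nth (time_deriv n gamma_kdv) c =
     nth (D_pow (int n) * gamma_kdv - gamma_kdv * D_pow (int n) :: 'a oper) c" by simp
qed

section \<open>Order bounds and convergent sums of operators\<close>

text \<open>
  The order is allowed to grow by \<open>\<beta>\<close> with every factor of the monomial, so that \<open>M\<close> counts as an
  operator of order \<open>-1\<close> for large \<open>\<beta>\<close>.
\<close>

definition ord_le :: "param multiset \<Rightarrow> nat \<Rightarrow> int \<Rightarrow> 'a::function_algebra oper \<Rightarrow> bool" where
  "ord_le c \<beta> N P \<longleftrightarrow> (\<forall>b i. b \<subseteq># c \<longrightarrow> i > N + int (\<beta> * size b) \<longrightarrow> coef (nth P b) i = 0)"

lemma ord_leD: "ord_le c 0 N P \<Longrightarrow> i > N \<Longrightarrow> coef (nth P c) i = 0"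
  by (simp add: ord_le_def)

lemma ord_le_0 [simp]: "ord_le c \<beta> N 0"
  by (simp add: ord_le_def)

lemma ord_le_add: "ord_le c \<beta> N P \<Longrightarrow> ord_le c \<beta> N Q \<Longrightarrow> ord_le c \<beta> N (P + Q)"
  by (simp add: ord_le_def)

lemma ord_le_uminus: "ord_le c \<beta> N P \<Longrightarrow> ord_le c \<beta> N (- P)"
  by (simp add: ord_le_def)

lemma ord_le_diff: "ord_le c \<beta> N P \<Longrightarrow> ord_le c \<beta> N Q \<Longrightarrow> ord_le c \<beta> N (P - Q)"
  by (simp add: ord_le_def)

lemma ord_le_scaleR: "ord_le c \<beta> N P \<Longrightarrow> ord_le c \<beta> N (r *\<^sub>R P)"
  by (simp add: ord_le_def)

lemma ord_le_mono: "ord_le c \<beta> N P \<Longrightarrow> N \<le> N' \<Longrightarrow> ord_le c \<beta> N' P"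
  by (auto simp: ord_le_def)

lemma ord_le_weaken: "ord_le c 0 N P \<Longrightarrow> ord_le c \<beta> N P"
  unfolding ord_le_def
proof (intro allI impI)
  fix b i
  assume "\<forall>b i. b \<subseteq># c \<longrightarrow> N + int (0 * size b) < i \<longrightarrow> coef (nth P b) i = 0"
    and "b \<subseteq># c" "N + int (\<beta> * size b) < i"
  moreover from this have "N < i" by (smt (verit) of_nat_0_le_iff)
  ultimately show "coef (nth P b) i = 0" by simp
qed

text \<open>Trades the slope \<beta> for a uniform bound: no divisor of c has more than
  \<open>size c\<close> factors.\<close>

lemma ord_le_forget:
  assumes "ord_le c \<beta> N P"
  shows "ord_le c 0 (N + int (\<beta> * size c)) P"
  unfolding ord_le_def
proof (intro allI impI)
  fix b i
  assume b: "b \<subseteq># c" and i: "N + int (\<beta> * size c) + int (0 * size b) < i"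
  have "\<beta> * size b \<le> \<beta> * size c" using size_mset_mono[OF b] by simp
  then have "N + int (\<beta> * size b) < i" using i by linarith
  then show "coef (nth P b) i = 0" using assms b by (simp add: ord_le_def)
qed

text \<open>The allowance is linear in the size of the monomial, and sizes add under b = a + (b -
  a), so the slope is preserved and only the offsets add.\<close>

lemma ord_le_mult:
  assumes "ord_le c \<beta> N P" "ord_le c \<beta> K Q"
  shows "ord_le c \<beta> (N + K) (P * Q)"
  unfolding ord_le_def
proof (intro allI impI)
  fix b i
  assume b: "b \<subseteq># c" and i: "N + K + int (\<beta> * size b) < i"
  have "coef (nth P a * nth Q (b - a)) i = 0" if a: "a \<subseteq># b" for a
  proof (rule coef_mult_eq_0)
    have "a \<subseteq># c" "b - a \<subseteq># c" using a b by (meson diff_subset_eq_self subset_mset.order_trans)+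
    then show "\<And>j. j > N + int (\<beta> * size a) \<Longrightarrow> coef (nth P a) j = 0"
      and "\<And>j. j > K + int (\<beta> * size (b - a)) \<Longrightarrow> coef (nth Q (b - a)) j = 0"
      using assms by (simp_all add: ord_le_def)
    have "size b = size a + size (b - a)"
      using a by (metis size_union subset_mset.add_diff_inverse)
    then show "N + int (\<beta> * size a) + (K + int (\<beta> * size (b - a))) < i"
      using i by (simp add: algebra_simps)
  qed
  then show "coef (nth (P * Q) b) i = 0" by (simp add: nth_mult)
qed

lemma ord_le_1: "ord_le c \<beta> 0 1"
  unfolding ord_le_def
proof (intro allI impI)
  fix b :: "param multiset" and i
  assume "0 + int (\<beta> * size b) < i"
  then have "0 < i" by linarith
  then show "coef (nth 1 b) i = 0" by (simp add: one_series.rep_eq one_psido.rep_eq)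
qed

lemma ord_le_power: "ord_le c \<beta> N P \<Longrightarrow> ord_le c \<beta> (int k * N) (P ^ k)"
proof (induction k)
  case (Suc k)
  then show ?case using ord_le_mult[of c \<beta> N P "int k * N" "P ^ k"] by (simp add: algebra_simps)
qed (simp add: ord_le_1)

lemma ord_le_neg_part: "ord_le c \<beta> (- 1) (neg_part P)"
  unfolding ord_le_def neg_part_def
proof (intro allI impI)
  fix b :: "param multiset" and i
  assume "- 1 + int (\<beta> * size b) < i"
  then have "\<not> i < 0" by linarith
  then show "coef (nth (series_map psido_neg P) b) i = 0" by simp
qed

text \<open>A monomial has finitely many divisors, so the maximum of their orders exists.\<close>

lemma ord_le_exists: obtains N where "N \<ge> 0" "ord_le c 0 N P"
proof -
  have "\<exists>N. \<forall>i>N. coef (nth P b) i = 0" for b by (metis coef_bound)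
  then obtain B where B: "\<And>b i. i > B b \<Longrightarrow> coef (nth P b) i = 0" by metis
  define N where "N = Max (insert 0 (B ` {b. b \<subseteq># c}))"
  have fin: "finite (insert 0 (B ` {b. b \<subseteq># c}))" by (simp add: finite_submultisets)
  have "N \<ge> 0" unfolding N_def using fin by (intro Max_ge) auto
  moreover have "B b \<le> N" if "b \<subseteq># c" for b
    unfolding N_def using fin that by (intro Max_ge) auto
  then have "ord_le c 0 N P" unfolding ord_le_def using B by fastforce
  ultimately show ?thesis using that by blast
qed

section \<open>The topology of orders: separation and unordered sums\<close>

lemma oper_eq_0I:
  assumes "\<And>c N. ord_le c 0 N P"
  shows "P = 0"
proof (intro series_eqI psido_eqI)
  fix c i
  show "coef (nth P c) i = coef (nth 0 c) i"
    using ord_leD[OF assms, of "i - 1" i] by simp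
qed

text \<open>Unordered summability in the topology whose neighbourhoods of 0 are the sets
  \<open>ord_le c 0 N\<close>: low order at all divisors of one monomial.\<close>

definition oper_sums :: "('k \<Rightarrow> 'a::function_algebra oper) \<Rightarrow> 'a oper \<Rightarrow> bool" where
  "oper_sums f W \<longleftrightarrow>
     (\<forall>c N. eventually (\<lambda>K. ord_le c 0 N (W - sum f K)) (finite_subsets_at_top UNIV))"

text \<open>Convergence to 0 in the same topology. As it is non-archimedean, this suffices for
  summability.\<close>

definition oper_null :: "('k \<Rightarrow> 'a::function_algebra oper) \<Rightarrow> bool" where
  "oper_null f \<longleftrightarrow> (\<forall>c N. finite {k. \<not> ord_le c 0 N (f k)})"

text \<open>Written in the shape of \<open>exp_M_q_L\<close>, so that the exponential is an instance
  by unfolding.\<close>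

definition oper_suminf :: "('k \<Rightarrow> 'a::function_algebra oper) \<Rightarrow> 'a oper" where
  "oper_suminf f = Series (\<lambda>c. Psido (\<lambda>i.
     \<Sum>k | coef (nth (f k) c) i \<noteq> 0. coef (nth (f k) c) i))"

lemma oper_sumsE:
  assumes "oper_sums f W"
  obtains X where "finite X" "\<And>Y. finite Y \<Longrightarrow> X \<subseteq> Y \<Longrightarrow> ord_le c 0 N (W - sum f Y)"
proof -
  have "\<exists>X. finite X \<and> (\<forall>Y. finite Y \<and> X \<subseteq> Y \<longrightarrow> ord_le c 0 N (W - sum f Y))"
    using assms by (simp add: oper_sums_def eventually_finite_subsets_at_top)
  then show ?thesis using that by metis
qed

lemma oper_sums_unique:
  assumes "oper_sums f W" "oper_sums f V"
  shows "W = V"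
proof -
  have "ord_le c 0 N (W - V)" for c N
  proof -
    from oper_sumsE[OF assms(1), of c N]
    obtain X where X: "finite X" "\<And>Y. finite Y \<Longrightarrow> X \<subseteq> Y \<Longrightarrow> ord_le c 0 N (W - sum f Y)"
      by blast
    from oper_sumsE[OF assms(2), of c N]
    obtain Z where Z: "finite Z" "\<And>Y. finite Y \<Longrightarrow> Z \<subseteq> Y \<Longrightarrow> ord_le c 0 N (V - sum f Y)"
      by blast
    have "ord_le c 0 N (W - sum f (X \<union> Z))" "ord_le c 0 N (V - sum f (X \<union> Z))"
      using X Z by auto
    from ord_le_diff[OF this] show ?thesis by simp
  qed
  then have "W - V = 0" by (rule oper_eq_0I)
  then show ?thesis by simp
qed

text \<open>\<open>Psido_inverse\<close> needs one order bound for all terms: at c all but finitely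
  many have order at most 0, and each of the others has its own bound.\<close>

lemma coef_oper_suminf:
  assumes "oper_null f"
  shows "coef (nth (oper_suminf f) c) i = (\<Sum>k | coef (nth (f k) c) i \<noteq> 0. coef (nth (f k) c) i)"
proof -
  have "\<exists>N. ord_le c 0 N (f k)" for k by (meson ord_le_exists)
  then obtain B where B: "\<And>k. ord_le c 0 (B k) (f k)" by metis
  define K where "K = {k. \<not> ord_le c 0 0 (f k)}"
  define N where "N = Max (insert 0 (B ` K))"
  have fin: "finite (insert 0 (B ` K))" using assms by (simp add: oper_null_def K_def)
  have "ord_le c 0 N (f k)" for k
  proof (cases "k \<in> K")
    case True
    then have "B k \<le> N" unfolding N_def using fin by (intro Max_ge) auto
    then show ?thesis using B ord_le_mono by blast
  next
    case False
    have "0 \<le> N" unfolding N_def using fin by (intro Max_ge) auto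
    then show ?thesis using False ord_le_mono by (auto simp: K_def)
  qed
  then have "\<forall>i>N. (\<Sum>k | coef (nth (f k) c) i \<noteq> 0. coef (nth (f k) c) i) = 0"
    using ord_leD by (metis (mono_tags, lifting) sum.neutral)
  then have "coef (Psido (\<lambda>i. \<Sum>k | coef (nth (f k) c) i \<noteq> 0. coef (nth (f k) c) i)) =
      (\<lambda>i. \<Sum>k | coef (nth (f k) c) i \<noteq> 0. coef (nth (f k) c) i)"
    by (intro Psido_inverse) blast
  then show ?thesis by (simp add: oper_suminf_def)
qed

lemma oper_sums_suminf:
  assumes "oper_null f"
  shows "oper_sums f (oper_suminf f)"
  unfolding oper_sums_def
proof (intro allI)
  fix c N
  \<comment> \<open>Outside this finite set no term reaches above order N at a divisor of c, so any
    finite set containing it gives the full sum there.\<close>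
  define K0 where "K0 = {k. \<not> ord_le c 0 N (f k)}"
  have "ord_le c 0 N (oper_suminf f - sum f K)" if K: "finite K" "K0 \<subseteq> K" for K
    unfolding ord_le_def
  proof (intro allI impI)
    fix b i
    assume b: "b \<subseteq># c" and i: "N + int (0 * size b) < i"
    have "{k. coef (nth (f k) b) i \<noteq> 0} \<subseteq> K0"
      using b i by (auto simp: K0_def ord_le_def)
    then have "(\<Sum>k | coef (nth (f k) b) i \<noteq> 0. coef (nth (f k) b) i) = (\<Sum>k\<in>K. coef (nth (f k) b) i)"
      using K by (intro sum.mono_neutral_left) auto
    then show "coef (nth (oper_suminf f - sum f K) b) i = 0"
      by (simp add: coef_oper_suminf[OF assms])
  qed
  moreover have "finite K0" using assms by (simp add: oper_null_def K0_def)
  ultimately show "eventually (\<lambda>K. ord_le c 0 N (oper_suminf f - sum f K)) (finite_subsets_at_top UNIV)"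
    unfolding eventually_finite_subsets_at_top by (intro exI[of _ K0]) auto
qed

lemma ord_le_suminf:
  assumes "oper_null f" "\<And>k. ord_le c \<beta> N (f k)"
  shows "ord_le c \<beta> N (oper_suminf f)"
  using assms unfolding ord_le_def by (auto simp: coef_oper_suminf)

lemma oper_sums_telescope:
  fixes g :: "nat \<Rightarrow> 'a::function_algebra oper"
  assumes "oper_sums (\<lambda>k. g k - g (Suc k)) W" "oper_null g"
  shows "W = g 0"
proof -
  have "ord_le c 0 N (W - g 0)" for c N
  proof -
    from oper_sumsE[OF assms(1), of c N]
    obtain X where X: "finite X"
      "\<And>Y. finite Y \<Longrightarrow> X \<subseteq> Y \<Longrightarrow> ord_le c 0 N (W - (\<Sum>k\<in>Y. g k - g (Suc k)))"
      by blast
    have "finite (X \<union> {k. \<not> ord_le c 0 N (g k)})"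
      using X(1) assms(2) by (simp add: oper_null_def)
    \<comment> \<open>The initial segment below m contains X, while m itself avoids the exceptional
      indices, so the remainder \<open>g m\<close> is small.\<close>
    then obtain m where m: "X \<union> {k. \<not> ord_le c 0 N (g k)} \<subseteq> {..<m}"
      by (meson finite_nat_iff_bounded)
    then have "ord_le c 0 N (g m)" by auto
    moreover have "ord_le c 0 N (W - (\<Sum>k<m. g k - g (Suc k)))" using X(2) m by auto
    ultimately have "ord_le c 0 N (W - (\<Sum>k<m. g k - g (Suc k)) - g m)" by (rule ord_le_diff[rotated])
    then show ?thesis by (simp add: sum_lessThan_telescope')
  qed
  then have "W - g 0 = 0" by (rule oper_eq_0I)
  then show ?thesis by simp
qed

section \<open>Continuous linear maps\<close>

text \<open>The last clause is continuity at 0 in the topology of orders, which lets the map pass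
  through infinite sums.\<close>

definition cont_linear :: "('a::function_algebra oper \<Rightarrow> 'a oper) \<Rightarrow> bool" where
  "cont_linear H \<longleftrightarrow> (\<forall>P Q. H (P + Q) = H P + H Q) \<and> (\<forall>r P. H (r *\<^sub>R P) = r *\<^sub>R H P) \<and>
     (\<forall>c N. \<exists>c' N'. \<forall>P. ord_le c' 0 N' P \<longrightarrow> ord_le c 0 N (H P))"

lemma cont_linear_add: "cont_linear H \<Longrightarrow> H (P + Q) = H P + H Q"
  and cont_linear_scaleR: "cont_linear H \<Longrightarrow> H (r *\<^sub>R P) = r *\<^sub>R H P"
  by (simp_all add: cont_linear_def)

lemma cont_linear_0: "cont_linear H \<Longrightarrow> H 0 = 0"
  using cont_linear_scaleR[of H 0 0] by simp

lemma cont_linear_diff: "cont_linear H \<Longrightarrow> H (P - Q) = H P - H Q"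
  using cont_linear_add[of H "P - Q" Q] by simp

lemma cont_linear_sum: "cont_linear H \<Longrightarrow> H (sum f K) = (\<Sum>k\<in>K. H (f k))"
  by (induction K rule: infinite_finite_induct) (auto simp: cont_linear_0 cont_linear_add)

lemma cont_linear_ident: "cont_linear (\<lambda>P. P)"
  by (auto simp: cont_linear_def)

lemma cont_linear_compose:
  assumes "cont_linear G" "cont_linear H"
  shows "cont_linear (\<lambda>P. G (H P))"
  using assms unfolding cont_linear_def by metis

lemma cont_linear_plus:
  assumes "cont_linear G" "cont_linear H"
  shows "cont_linear (\<lambda>P. G P + H P)"
  unfolding cont_linear_def
proof (intro conjI allI)
  fix c N
  obtain c1 N1 where 1: "\<And>P. ord_le c1 0 N1 P \<Longrightarrow> ord_le c 0 N (G P)"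
    using assms(1) unfolding cont_linear_def by meson
  obtain c2 N2 where 2: "\<And>P. ord_le c2 0 N2 P \<Longrightarrow> ord_le c 0 N (H P)"
    using assms(2) unfolding cont_linear_def by meson
  \<comment> \<open>The divisors of \<open>c1 + c2\<close> include those of both \<open>c1\<close>
    and \<open>c2\<close>, so one neighbourhood serves both maps.\<close>
  have "ord_le c 0 N (G P + H P)" if "ord_le (c1 + c2) 0 (min N1 N2) P" for P
  proof (rule ord_le_add)
    have "ord_le c1 0 N1 P" "ord_le c2 0 N2 P"
      using that subset_mset.order_trans[OF _ mset_subset_eq_add_left[of c1 c2]]
        subset_mset.order_trans[OF _ mset_subset_eq_add_right[of c2 c1]]
      by (simp_all add: ord_le_def)
    then show "ord_le c 0 N (G P)" "ord_le c 0 N (H P)" using 1 2 by auto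
  qed
  then show "\<exists>c' N'. \<forall>P. ord_le c' 0 N' P \<longrightarrow> ord_le c 0 N (G P + H P)" by blast
qed (use assms in \<open>simp_all add: cont_linear_def scaleR_add_right\<close>)

lemma cont_linear_uminus:
  assumes "cont_linear H"
  shows "cont_linear (\<lambda>P. - H P)"
  using assms unfolding cont_linear_def by (metis minus_add_distrib ord_le_uminus scaleR_minus_right)

lemma cont_linear_minus:
  assumes "cont_linear G" "cont_linear H"
  shows "cont_linear (\<lambda>P. G P - H P)"
  using cont_linear_plus[OF assms(1) cont_linear_uminus[OF assms(2)]] by simp

lemma cont_linear_mult_left:
  assumes "cont_linear H"
  shows "cont_linear (\<lambda>P. Q * H P)"
proof (rule cont_linear_compose[OF _ assms])
  show "cont_linear (\<lambda>P. Q * P)"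
    unfolding cont_linear_def
  proof (intro conjI allI)
    fix c N
    obtain K where "ord_le c 0 K Q" by (meson ord_le_exists)
    then have "ord_le c 0 N (Q * P)" if "ord_le c 0 (N - K) P" for P
      using ord_le_mult[OF _ that, of K Q] by simp
    then show "\<exists>c' N'. \<forall>P. ord_le c' 0 N' P \<longrightarrow> ord_le c 0 N (Q * P)" by blast
  qed (simp_all add: distrib_left)
qed

lemma cont_linear_mult_right:
  assumes "cont_linear H"
  shows "cont_linear (\<lambda>P. H P * Q)"
proof (rule cont_linear_compose[OF _ assms])
  show "cont_linear (\<lambda>P. P * Q)"
    unfolding cont_linear_def
  proof (intro conjI allI)
    fix c N
    obtain K where "ord_le c 0 K Q" by (meson ord_le_exists)
    then have "ord_le c 0 N (P * Q)" if "ord_le c 0 (N - K) P" for P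
      using ord_le_mult[OF that, of K Q] by simp
    then show "\<exists>c' N'. \<forall>P. ord_le c' 0 N' P \<longrightarrow> ord_le c 0 N (P * Q)" by blast
  qed (simp_all add: distrib_right)
qed

lemma neg_part_add: "neg_part (P + Q) = neg_part P + neg_part Q"
  by (intro series_eqI psido_eqI) (simp add: neg_part_def)

lemma neg_part_diff: "neg_part (P - Q) = neg_part P - neg_part Q"
  by (intro series_eqI psido_eqI) (simp add: neg_part_def)

lemma neg_part_scaleR: "neg_part (r *\<^sub>R P) = r *\<^sub>R neg_part P"
  by (intro series_eqI psido_eqI) (simp add: neg_part_def)

lemma cont_linear_neg_part:
  assumes "cont_linear H"
  shows "cont_linear (\<lambda>P. neg_part (H P))"
proof (rule cont_linear_compose[OF _ assms])
  have "ord_le c 0 N (neg_part P)" if "ord_le c 0 N P" for c N and P :: "'a oper"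
    using that by (simp add: ord_le_def neg_part_def)
  then show "cont_linear (neg_part :: 'a oper \<Rightarrow> _)"
    unfolding cont_linear_def neg_part_add neg_part_scaleR by blast
qed

text \<open>The coefficient at b is read off at b or at b times t_n, so controlling c requires
  controlling c enlarged by one factor.\<close>

lemma cont_linear_time_deriv: "cont_linear (time_deriv n)"
proof -
  have "ord_le c 0 N (time_deriv n P)" if P: "ord_le (add_mset (Time n) c) 0 N P" for c N and P :: "'a oper"
    unfolding ord_le_def
  proof (intro allI impI)
    fix b i
    assume b: "b \<subseteq># c" and i: "N + int (0 * size b) < i"
    have "b \<subseteq># add_mset (Time n) c" using b by (auto intro: subset_mset.order_trans)
    moreover have "add_mset (Time n) b \<subseteq># add_mset (Time n) c" using b by simp
    ultimately show "coef (nth (time_deriv n P) b) i = 0"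
      using P i by (auto simp: ord_le_def time_deriv_def)
  qed
  then show ?thesis
    unfolding cont_linear_def time_deriv_add time_deriv_scaleR by blast
qed

lemmas cont_linear_intros = cont_linear_ident cont_linear_plus cont_linear_minus cont_linear_uminus
  cont_linear_mult_left cont_linear_mult_right cont_linear_neg_part

lemma oper_sums_cont_linear:
  assumes H: "cont_linear H" and f: "oper_sums f W"
  shows "oper_sums (\<lambda>k. H (f k)) (H W)"
  unfolding oper_sums_def
proof (intro allI)
  fix c N
  obtain c' N' where 1: "\<And>P. ord_le c' 0 N' P \<Longrightarrow> ord_le c 0 N (H P)"
    using H unfolding cont_linear_def by meson
  have "eventually (\<lambda>K. ord_le c' 0 N' (W - sum f K)) (finite_subsets_at_top UNIV)"
    using f by (simp add: oper_sums_def)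
  then show "eventually (\<lambda>K. ord_le c 0 N (H W - (\<Sum>k\<in>K. H (f k)))) (finite_subsets_at_top UNIV)"
  proof eventually_elim
    case (elim K)
    from 1[OF this] show ?case by (simp add: cont_linear_diff[OF H] cont_linear_sum[OF H])
  qed
qed

lemma oper_null_cont_linear:
  assumes H: "cont_linear H" and f: "oper_null f"
  shows "oper_null (\<lambda>k. H (f k))"
  unfolding oper_null_def
proof (intro allI)
  fix c N
  obtain c' N' where 1: "\<And>P. ord_le c' 0 N' P \<Longrightarrow> ord_le c 0 N (H P)"
    using H unfolding cont_linear_def by meson
  have "{k. \<not> ord_le c 0 N (H (f k))} \<subseteq> {k. \<not> ord_le c' 0 N' (f k)}" using 1 by auto
  then show "finite {k. \<not> ord_le c 0 N (H (f k))}"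
    using f by (auto simp: oper_null_def intro: finite_subset)
qed

section \<open>The geometric series\<close>

lemma oper_null_power:
  assumes "\<And>c. ord_le c 0 (- 1) A"
  shows "oper_null (\<lambda>k. A ^ k)"
  unfolding oper_null_def
proof (intro allI)
  fix c N
  have "{k. \<not> ord_le c 0 N (A ^ k)} \<subseteq> {..nat (- N)}"
  proof
    fix k assume "k \<in> {k. \<not> ord_le c 0 N (A ^ k)}"
    then have "\<not> int k * - 1 \<le> N" using ord_le_power[OF assms] ord_le_mono by blast
    then show "k \<in> {..nat (- N)}" by simp
  qed
  then show "finite {k. \<not> ord_le c 0 N (A ^ k)}" by (rule finite_subset) simp
qed

lemma oper_inverse_eqI:
  assumes "S * T = 1" "T * S = 1"
  shows "oper_inverse S = T"
  unfolding oper_inverse_def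
proof (rule the_equality)
  fix T' assume "S * T' = 1 \<and> T' * S = 1"
  then have "T' = T' * (S * T)" using assms by simp
  also have "\<dots> = T" using \<open>S * T' = 1 \<and> T' * S = 1\<close> by (simp flip: mult.assoc)
  finally show "T' = T" .
qed (use assms in simp)

text \<open>Multiplication is continuous, so each product is the sum of A^k - A^(k+1), which
  telescopes to A^0 because the powers tend to 0.\<close>

lemma geometric_series:
  assumes "\<And>c. ord_le c 0 (- 1) A"
  shows "(1 - A) * oper_suminf (\<lambda>k. A ^ k) = 1" "oper_suminf (\<lambda>k. A ^ k) * (1 - A) = 1"
proof -
  let ?T = "oper_suminf (\<lambda>k. A ^ k)"
  note s = oper_sums_suminf[OF oper_null_power[OF assms]]
  have "oper_sums (\<lambda>k. A ^ k - A ^ Suc k) ((1 - A) * ?T)"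
    using oper_sums_cont_linear[OF cont_linear_mult_left[OF cont_linear_ident] s, of "1 - A"]
    by (simp add: algebra_simps)
  from oper_sums_telescope[OF this oper_null_power[OF assms]] show "(1 - A) * ?T = 1" by simp
  have "oper_sums (\<lambda>k. A ^ k - A ^ Suc k) (?T * (1 - A))"
    using oper_sums_cont_linear[OF cont_linear_mult_right[OF cont_linear_ident] s, of "1 - A"]
    by (simp add: algebra_simps power_commutes)
  from oper_sums_telescope[OF this oper_null_power[OF assms]] show "?T * (1 - A) = 1" by simp
qed

lemma oper_inverse_geometric:
  assumes "\<And>c. ord_le c 0 (- 1) A"
  shows "oper_inverse (1 - A) = oper_suminf (\<lambda>k. A ^ k)"
  by (rule oper_inverse_eqI) (use geometric_series[OF assms] in auto)

lemma dressing_inverse: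
  assumes "dressing S"
  shows "S * oper_inverse S = 1" "oper_inverse S * S = 1"
    and "ord_le c 0 0 S" "ord_le c 0 0 (oper_inverse S)"
proof -
  \<comment> \<open>S is 1 minus an operator of order -1, so its inverse is the geometric series of
    A, whose terms all have order at most 0.\<close>
  define A where "A = - neg_part S"
  have S: "S = 1 - A" using assms by (simp add: dressing_def A_def)
  have A: "ord_le c 0 (- 1) A" for c unfolding A_def by (intro ord_le_uminus ord_le_neg_part)
  have T: "oper_inverse S = oper_suminf (\<lambda>k. A ^ k)" unfolding S by (rule oper_inverse_geometric[OF A])
  show "S * oper_inverse S = 1" "oper_inverse S * S = 1"
    unfolding T unfolding S by (rule geometric_series[OF A])+
  show "ord_le c 0 0 S" unfolding S by (intro ord_le_diff ord_le_1 ord_le_mono[OF A]) simp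
  show "ord_le c 0 0 (oper_inverse S)"
    unfolding T
  proof (rule ord_le_suminf[OF oper_null_power[OF A]])
    show "ord_le c 0 0 (A ^ k)" for k using ord_le_mono[OF ord_le_power[OF A]] by simp
  qed
qed

lemma power_scaleR: "(r *\<^sub>R x) ^ n = r ^ n *\<^sub>R (x :: 'b::real_algebra_1) ^ n"
  by (induction n) simp_all

text \<open>H maps the resolvent to the sum of r^k H(A^k). At fixed c and i only finitely many k
  contribute, with a bound not depending on r because H(A^k) tends to 0.\<close>

lemma resolvent_polynomial:
  fixes A :: "'a::function_algebra oper"
  assumes H: "cont_linear H" and A: "\<And>c. ord_le c 0 (- 1) A"
  shows "\<exists>p :: 'a poly.
    (\<forall>r. coef (nth (H (oper_inverse (1 - r *\<^sub>R A))) c) i = poly p (of_real r)) \<and>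
    coeff p 0 = coef (nth (H 1) c) i \<and> coeff p 1 = coef (nth (H A) c) i"
proof -
  define a where "a k = coef (nth (H (A ^ k)) c) i" for k
  have "finite {k. \<not> ord_le c 0 (i - 1) (H (A ^ k))}"
    using oper_null_cont_linear[OF H oper_null_power[OF A]] by (simp add: oper_null_def)
  then obtain m0 where m0: "{k. \<not> ord_le c 0 (i - 1) (H (A ^ k))} \<subseteq> {..<m0}"
    by (meson finite_nat_iff_bounded)
  \<comment> \<open>The extra 2 keeps the degrees 0 and 1 in range, so that both coefficients can be
    read off.\<close>
  define m where "m = m0 + 2"
  have a0: "a k = 0" if "k \<ge> m" for k
  proof -
    have "ord_le c 0 (i - 1) (H (A ^ k))" using m0 that by (auto simp: m_def)
    then show ?thesis unfolding a_def by (rule ord_leD) simp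
  qed
  define p where "p = (\<Sum>k<m. monom (a k) k)"
  show ?thesis
  proof (intro exI[of _ p] conjI allI)
    fix r :: real
    have rA: "ord_le c 0 (- 1) (r *\<^sub>R A)" for c using A by (rule ord_le_scaleR)
    have "oper_sums (\<lambda>k. H ((r *\<^sub>R A) ^ k)) (H (oper_inverse (1 - r *\<^sub>R A)))"
      unfolding oper_inverse_geometric[OF rA]
      by (intro oper_sums_cont_linear[OF H] oper_sums_suminf oper_null_power rA)
    from oper_sumsE[OF this, of c "i - 1"]
    obtain X where X: "finite X" "\<And>Y. finite Y \<Longrightarrow> X \<subseteq> Y \<Longrightarrow>
        ord_le c 0 (i - 1) (H (oper_inverse (1 - r *\<^sub>R A)) - (\<Sum>k\<in>Y. H ((r *\<^sub>R A) ^ k)))"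
      by blast
    \<comment> \<open>Order at most i - 1 kills the coefficient at i, so there the partial sum is
      exact; its terms with k \<ge> m vanish.\<close>
    have "ord_le c 0 (i - 1)
        (H (oper_inverse (1 - r *\<^sub>R A)) - (\<Sum>k\<in>X \<union> {..<m}. H ((r *\<^sub>R A) ^ k)))"
      using X by auto
    from ord_leD[OF this, of i]
    have "coef (nth (H (oper_inverse (1 - r *\<^sub>R A))) c) i = (\<Sum>k\<in>X \<union> {..<m}. r ^ k *\<^sub>R a k)"
      by (simp add: power_scaleR cont_linear_scaleR[OF H] a_def)
    also have "\<dots> = (\<Sum>k<m. r ^ k *\<^sub>R a k)"
      using X(1) a0 by (intro sum.mono_neutral_right) auto
    also have "\<dots> = poly p (of_real r)"
      by (simp add: p_def poly_sum poly_monom scaleR_conv_of_real mult.commute)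
    finally show "coef (nth (H (oper_inverse (1 - r *\<^sub>R A))) c) i = poly p (of_real r)" .
  next
    have "coeff p k = a k" if "k < m" for k
      using that by (simp add: p_def coeff_sum coeff_monom)
    from this[of 0] this[of 1]
    show "coeff p 0 = coef (nth (H 1) c) i" "coeff p 1 = coef (nth (H A) c) i"
      by (simp_all add: a_def m_def)
  qed
qed

section \<open>The additional flows\<close>

definition evolves :: "nat \<Rightarrow> 'a::function_algebra oper \<Rightarrow> 'a oper \<Rightarrow> bool" where
  "evolves n B P \<longleftrightarrow> time_deriv n P = B * P - P * B"

text \<open>\<open>evolves\<close> says that the derivation \<partial>_n - [B, .] kills P; the
  kernel of a derivation is closed under products.\<close>

lemma evolves_mult: "evolves n B P \<Longrightarrow> evolves n B Q \<Longrightarrow> evolves n B (P * Q)"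
  by (simp add: evolves_def time_deriv_mult left_diff_distrib right_diff_distrib mult.assoc)

lemma evolves_power: "evolves n B P \<Longrightarrow> evolves n B (P ^ k)"
  by (induction k) (simp_all add: evolves_mult, simp add: evolves_def time_deriv_one)

lemma evolves_scaleR: "evolves n B P \<Longrightarrow> evolves n B (r *\<^sub>R P)"
  by (simp add: evolves_def time_deriv_scaleR scaleR_diff_right)

lemma evolves_log_q: "evolves n B log_q"
  by (simp add: evolves_def time_deriv_log_q log_q_commute)

text \<open>This derivation is continuous, so its kernel is closed under convergent sums.\<close>

lemma evolves_sums:
  assumes "oper_sums f W" "\<And>k. evolves n B (f k)"
  shows "evolves n B W"
proof -
  have "oper_sums (\<lambda>k. B * f k - f k * B) (B * W - W * B)"
    by (intro oper_sums_cont_linear[OF _ assms(1)] cont_linear_intros)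
  moreover have "oper_sums (\<lambda>k. time_deriv n (f k)) (time_deriv n W)"
    by (rule oper_sums_cont_linear[OF cont_linear_time_deriv assms(1)])
  ultimately show ?thesis
    using assms(2) oper_sums_unique by (auto simp: evolves_def)
qed

text \<open>As \<open>B * S = S * D\<close>, the equation for S reads \<partial>_n S = B_+ S - S D.
  Conjugation by S thus turns \<partial>_n - D into \<partial>_n - B_+, and commutation with G into
  commutation with the dressed operator.\<close>

lemma evolves_dressed:
  assumes S: "S * T = 1" "T * S = 1" and D: "evolves n D G"
    and B: "B = S * D * T" and dS: "time_deriv n S = - neg_part B * S"
  shows "evolves n (B - neg_part B) (S * G * T)"
proof -
  let ?M = "S * G * T"
  have TS: "X * T * S = X" for X using S by (simp add: mult.assoc)
  have ST: "X * S * T = X" for X using S by (simp add: mult.assoc)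
  have MS: "?M * S = S * G" and BS: "B * S = S * D" by (simp_all add: B TS)
  \<comment> \<open>Differentiating M S = S G needs no formula for the derivative of T; S is
    cancelled by T at the end.\<close>
  have "time_deriv n ?M * S + ?M * time_deriv n S = time_deriv n S * G + S * time_deriv n G"
    using arg_cong[OF MS, of "time_deriv n"] by (simp add: time_deriv_mult)
  then have "time_deriv n ?M * S = time_deriv n S * G + S * time_deriv n G - ?M * time_deriv n S"
    by (simp only: eq_diff_eq)
  also have "\<dots> = ?M * neg_part B * S - neg_part B * (S * G) + (S * D * G - S * G * D)"
    using D by (simp add: dS evolves_def right_diff_distrib mult.assoc)
  also have "\<dots> = ?M * neg_part B * S - neg_part B * (?M * S) + (B * (?M * S) - ?M * (B * S))"
    by (simp only: MS BS flip: mult.assoc)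
  also have "\<dots> = ((B - neg_part B) * ?M - ?M * (B - neg_part B)) * S"
    by (simp add: algebra_simps)
  finally have "time_deriv n ?M * S * T = ((B - neg_part B) * ?M - ?M * (B - neg_part B)) * S * T"
    by (rule arg_cong)
  then show ?thesis
    unfolding evolves_def by (simp only: ST)
qed

section \<open>Convergence of the exponential\<close>

lemma ord_le_D_pow: "ord_le c \<beta> m (D_pow m)"
  unfolding ord_le_def
proof (intro allI impI)
  fix b :: "param multiset" and i
  assume "m + int (\<beta> * size b) < i"
  then have "m < i" by linarith
  then show "coef (nth (D_pow m) b) i = 0" by (simp add: D_pow_def series_const_def)
qed

lemma ord_le_orlov_shulman:
  assumes "dressing S"
  obtains \<beta> where "ord_le c \<beta> (- 1) (orlov_shulman S)"
proof -
  obtain N where N: "N \<ge> 0" "ord_le c 0 N (gamma_kdv :: 'a oper)" by (rule ord_le_exists)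
  \<comment> \<open>With slope N + 1 a nonempty monomial already allows order -1 + (N + 1) = N,
    while the empty one keeps the order -1 of the term in x.\<close>
  define \<beta> where "\<beta> = nat (N + 1)"
  have "ord_le c \<beta> (- 1) (gamma_kdv :: 'a oper)"
    unfolding ord_le_def
  proof (intro allI impI)
    fix b :: "param multiset" and i
    assume b: "b \<subseteq># c" and i: "- 1 + int (\<beta> * size b) < i"
    show "coef (nth (gamma_kdv :: 'a oper) b) i = 0"
    proof (cases "b = {#}")
      case True
      then show ?thesis using i by (simp add: gamma_kdv_def)
    next
      case False
      then have "size b \<ge> 1" by (metis Suc_eq_plus1 Suc_leI add_0 nonempty_has_size)
      then have "\<beta> \<le> \<beta> * size b" by simp
      then have "N < i" using i N(1) unfolding \<beta>_def by linarith
      then show ?thesis using N(2) b by (simp add: ord_le_def)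
    qed
  qed
  then have "ord_le c \<beta> (0 + - 1 + 0) (orlov_shulman S)"
    unfolding orlov_shulman_def
    by (intro ord_le_mult ord_le_weaken[OF dressing_inverse(3)[OF assms]]
        ord_le_weaken[OF dressing_inverse(4)[OF assms]])
  then show ?thesis using that by simp
qed

lemma nth_mult_log_q_power:
  "count c LogQ < s \<Longrightarrow> nth (P * log_q ^ s) c = (0 :: 'b::real_algebra_1)"
proof (induction s arbitrary: c)
  case (Suc s)
  have "nth (P * log_q ^ Suc s) c = nth ((P * log_q ^ s) * log_q) c"
    by (simp only: power_Suc2 mult.assoc)
  also have "\<dots> = 0"
  proof (cases "LogQ \<in># c")
    case True
    then have "0 < count c LogQ" by simp
    moreover have "count (c - {#LogQ#}) LogQ = count c LogQ - 1" by simp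
    ultimately have "count (c - {#LogQ#}) LogQ < s"
      using Suc.prems by linarith
    then show ?thesis using Suc.IH by (simp add: mult_log_q_nth)
  qed (simp add: mult_log_q_nth)
  finally show ?case .
qed simp

lemma ord_le_log_q: "ord_le c \<beta> 0 log_q"
  unfolding ord_le_def
proof (intro allI impI)
  fix b :: "param multiset" and i
  assume "0 + int (\<beta> * size b) < i"
  then have "0 < i" by linarith
  then show "coef (nth log_q b) i = 0" by (simp add: log_q_def one_psido.rep_eq)
qed

lemma ord_le_lax:
  assumes "dressing S"
  shows "ord_le c 0 2 (lax S)"
proof -
  have "ord_le c 0 (0 + 2 + 0) (lax S)"
    unfolding lax_def by (intro ord_le_mult ord_le_D_pow dressing_inverse[OF assms])
  then show ?thesis by simp
qed

lemma oper_null_exp_terms: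
  assumes "dressing S"
  shows "oper_null (\<lambda>(p, s). exp_M_q_L_term m n S p s)"
  unfolding oper_null_def
proof (intro allI)
  fix c N
  obtain \<beta> where M: "ord_le c \<beta> (- 1) (orlov_shulman S)" by (rule ord_le_orlov_shulman[OF assms])
  \<comment> \<open>At divisors of c the term has order at most -p + 2 s + \<beta>
    \<open>size c\<close>; for s \<le> \<open>count c LogQ\<close> this is at most N once p \<ge>
    \<open>P\<close>.\<close>
  define P where "P = 2 * int (count c LogQ) + int (\<beta> * size c) - N"
  have "{k. \<not> ord_le c 0 N (case k of (p, s) \<Rightarrow> exp_M_q_L_term m n S p s)} \<subseteq>
      {..nat P} \<times> {..count c LogQ}"
  proof clarify
    fix p s
    assume *: "\<not> ord_le c 0 N (exp_M_q_L_term m n S p s)"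
    have "s \<le> count c LogQ"
    proof (rule ccontr)
      assume s: "\<not> s \<le> count c LogQ"
      have "nth (exp_M_q_L_term m n S p s) b = 0" if "b \<subseteq># c" for b
      proof -
        have "count b LogQ < s" using s mset_subset_eq_count[OF that, of LogQ] by linarith
        then show ?thesis
          by (simp add: exp_M_q_L_term_def power_scaleR nth_mult_log_q_power)
      qed
      then show False using * by (simp add: ord_le_def)
    qed
    moreover have "p \<le> nat P"
    proof (rule ccontr)
      assume p: "\<not> p \<le> nat P"
      have "ord_le c \<beta> (int p * - 1 + int s * 2 + int s * 0) (exp_M_q_L_term m n S p s)"
        unfolding exp_M_q_L_term_def
        by (intro ord_le_scaleR ord_le_mult ord_le_power M ord_le_weaken[OF ord_le_lax[OF assms]] ord_le_log_q)
      from ord_le_mono[OF ord_le_forget[OF this], of N]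
      show False using * p \<open>s \<le> count c LogQ\<close> unfolding P_def by linarith
    qed
    ultimately show "p \<in> {..nat P} \<and> s \<in> {..count c LogQ}" by simp
  qed
  then show "finite {k. \<not> ord_le c 0 N (case k of (p, s) \<Rightarrow> exp_M_q_L_term m n S p s)}"
    by (rule finite_subset) simp
qed

lemma oper_sums_exp_M_q_L:
  assumes "dressing S"
  shows "oper_sums (\<lambda>(p, s). exp_M_q_L_term m n S p s) (exp_M_q_L m n S)"
proof -
  have "exp_M_q_L m n S = oper_suminf (\<lambda>(p, s). exp_M_q_L_term m n S p s)"
    unfolding exp_M_q_L_def oper_suminf_def by (simp add: case_prod_unfold)
  then show ?thesis using oper_sums_suminf[OF oper_null_exp_terms[OF assms]] by simp
qed

text \<open>\<Gamma> and \<partial>^2 both evolve by \<partial>^n, so dressing gives the evolution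
  of M and L; log q is constant and central, hence every term of the double series evolves, and so
  does its sum.\<close>

lemma evolves_exp_M_q_L:
  assumes "kdv_solution S" "odd n"
  defines "B \<equiv> lax_half_pow S n"
  shows "evolves n (B - neg_part B) (exp_M_q_L l k S)"
proof -
  have S: "dressing S" and dS: "time_deriv n S = - neg_part B * S"
    using assms by (simp_all add: kdv_solution_def kdv_flow_def)
  note dressed = evolves_dressed[OF dressing_inverse(1,2)[OF S] _ _ dS, of "D_pow (int n)"]
  have M: "evolves n (B - neg_part B) (orlov_shulman S)"
    unfolding orlov_shulman_def
    by (rule dressed) (use assms in \<open>simp_all add: evolves_def time_deriv_gamma_kdv lax_half_pow_def\<close>)
  have L: "evolves n (B - neg_part B) (lax S)"
    unfolding lax_def
    by (rule dressed)
      (simp_all add: evolves_def time_deriv_D_pow D_pow_mult add.commute B_def lax_half_pow_def)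
  show ?thesis
  proof (rule evolves_sums[OF oper_sums_exp_M_q_L[OF S]])
    show "evolves n (B - neg_part B) (case x of (p, s) \<Rightarrow> exp_M_q_L_term l k S p s)" for x
      by (cases x)
        (auto simp: exp_M_q_L_term_def intro!: evolves_scaleR evolves_mult evolves_power M L evolves_log_q)
  qed
qed

section \<open>The algebra of negative parts\<close>

lemma neg_part_eq_self:
  assumes "\<And>c. ord_le c 0 (- 1) P"
  shows "neg_part P = P"
proof (intro series_eqI psido_eqI)
  fix c i
  show "coef (nth (neg_part P) c) i = coef (nth P c) i"
    using ord_leD[OF assms, of i c] by (auto simp: neg_part_def)
qed

lemma neg_part_mult_neg_parts: "neg_part (neg_part P * neg_part Q) = neg_part P * neg_part Q"
proof (rule neg_part_eq_self)
  show "ord_le c 0 (- 1) (neg_part P * neg_part Q)" for c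
    using ord_le_mult[OF ord_le_neg_part ord_le_neg_part, of c 0 P Q] by (rule ord_le_mono) simp
qed

lemma neg_part_mult_differential:
  "neg_part ((P - neg_part P) * (Q - neg_part Q)) = 0"
proof (intro series_eqI psido_eqI)
  fix c i
  have "coef (nth (P - neg_part P) b * nth (Q - neg_part Q) (c - b)) i = 0" if "i < 0" for b
    by (rule coef_mult_differential) (use that in \<open>simp_all add: neg_part_def\<close>)
  then show "coef (nth (neg_part ((P - neg_part P) * (Q - neg_part Q))) c) i = coef (nth 0 c) i"
    by (simp add: neg_part_def nth_mult)
qed

text \<open>With C = B_+, the commutator of C with E_+ is differential, so [C, E]_- = [C, A]_-.
  Splitting B = C + B_- on the left gives [A, C]_- plus products of negative operators, which are
  their own negative parts, and B_- A cancels.\<close>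

lemma commutator_neg_part:
  fixes B E :: "'a::function_algebra oper"
  defines "A \<equiv> neg_part E" and "C \<equiv> B - neg_part B"
  shows "neg_part (A * B) - neg_part (B * A) + neg_part B * A =
    A * neg_part B - neg_part (C * E - E * C)"
proof -
  have E: "E = (E - A) + A" by simp
  have "neg_part (C * E - E * C) = neg_part (C * (E - A)) + neg_part (C * A)
      - neg_part ((E - A) * C) - neg_part (A * C)"
    by (simp add: neg_part_diff neg_part_add algebra_simps)
  moreover have "neg_part (C * (E - A)) = 0" "neg_part ((E - A) * C) = 0"
    unfolding A_def C_def by (rule neg_part_mult_differential)+
  ultimately have 1: "neg_part (C * E - E * C) = neg_part (C * A) - neg_part (A * C)" by simp
  have "neg_part (A * B) = neg_part (A * C) + neg_part (A * neg_part B)"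
    "neg_part (B * A) = neg_part (C * A) + neg_part (neg_part B * A)"
    by (simp_all add: C_def algebra_simps flip: neg_part_add)
  then show ?thesis
    unfolding 1 by (simp add: A_def neg_part_mult_neg_parts)
qed

text \<open>
  With \<open>A\<close> the negative part of the exponential, \<open>S + r \<partial>S = (1 - rA) S\<close>, so that the dressed power
  becomes \<open>(1 - rA) B (1 - rA)\<^sup>-\<^sup>1\<close> and the flow is a combination of three linear images of the
  resolvent.
\<close>

theorem theorem5p1:
  fixes S :: "'a::function_algebra oper" and l k n :: nat
  assumes "kdv_solution S" and "odd n"
  shows "commutes_with_kdv_flow (additional_flow l k) n S"
proof -
  define E where "E = exp_M_q_L l k S"
  define A where "A = neg_part E"
  define B where "B = lax_half_pow S n"
  define T where "T = oper_inverse S"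
  have S: "dressing S" and dS: "time_deriv n S = - neg_part B * S"
    using assms by (simp_all add: kdv_solution_def kdv_flow_def B_def)
  have inv: "S * T = 1" "T * S = 1" unfolding T_def by (fact dressing_inverse[OF S])+
  have A: "ord_le c 0 (- 1) A" for c unfolding A_def by (rule ord_le_neg_part)
  define R where "R r = oper_inverse (1 - r *\<^sub>R A)" for r
  have R: "(1 - r *\<^sub>R A) * R r = 1" "R r * (1 - r *\<^sub>R A) = 1" for r
    using geometric_series[OF ord_le_scaleR[OF A]] oper_inverse_geometric[OF ord_le_scaleR[OF A]]
    by (simp_all add: R_def)
  \<comment> \<open>\<open>H0\<close>, \<open>H1\<close> and \<open>H2\<close> collect the powers 0,
    1 and 2 of r in -((1 - rA) B R)_- (1 - rA) S, each linear in the resolvent R.\<close>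
  define H0 where "H0 Q = - (neg_part (B * Q) * S)" for Q
  define H1 where "H1 Q = neg_part (A * (B * Q)) * S + neg_part (B * Q) * (A * S)" for Q
  define H2 where "H2 Q = - (neg_part (A * (B * Q)) * (A * S))" for Q
  have H: "cont_linear H0" "cont_linear H1" "cont_linear H2"
    unfolding H0_def H1_def H2_def by (intro cont_linear_intros)+
  have flow: "kdv_flow n (S + r *\<^sub>R additional_flow l k S) =
      H0 (R r) + r *\<^sub>R H1 (R r) + (r * r) *\<^sub>R H2 (R r)" for r
  proof -
    let ?S = "(1 - r *\<^sub>R A) * S"
    have 1: "S + r *\<^sub>R additional_flow l k S = ?S"
      by (simp add: additional_flow_def A_def E_def algebra_simps)
    have "oper_inverse ?S = T * R r"
    proof (rule oper_inverse_eqI)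
      have "?S * (T * R r) = (1 - r *\<^sub>R A) * (S * T) * R r" by (simp only: mult.assoc)
      then show "?S * (T * R r) = 1" by (simp only: inv R mult_1_right)
      have "T * R r * ?S = T * (R r * (1 - r *\<^sub>R A)) * S" by (simp only: mult.assoc)
      then show "T * R r * ?S = 1" by (simp only: inv R mult_1_right)
    qed
    then have "lax_half_pow ?S n = (1 - r *\<^sub>R A) * (B * R r)"
      by (simp add: lax_half_pow_def B_def T_def mult.assoc)
    then show ?thesis
      unfolding 1 kdv_flow_def H0_def H1_def H2_def
      by (simp add: left_diff_distrib right_diff_distrib neg_part_diff neg_part_scaleR
          scaleR_add_right scaleR_diff_right mult.assoc)
  qed
  \<comment> \<open>The right side is the derivative of the flow at r = 0: the first-order term A of
    the resolvent enters through \<open>H0\<close>, its constant term 1 through \<open>H1\<close>,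
    and \<open>H2\<close> starts at r^2.\<close>
  have X: "time_deriv n (additional_flow l k S) = H0 A + H1 1"
  proof -
    have "time_deriv n E = (B - neg_part B) * E - E * (B - neg_part B)"
      using evolves_exp_M_q_L[OF assms, of l k] by (simp add: evolves_def E_def B_def)
    \<comment> \<open>The time derivative acts on coefficients only and leaves the powers of
      \<partial> in place.\<close>
    moreover have "time_deriv n (neg_part E) = neg_part (time_deriv n E)"
      by (intro series_eqI psido_eqI) (simp add: time_deriv_def neg_part_def)
    ultimately have dA: "time_deriv n A = neg_part ((B - neg_part B) * E - E * (B - neg_part B))"
      by (simp add: A_def)
    have "additional_flow l k S = (- 1) *\<^sub>R (A * S)"
      by (simp add: additional_flow_def A_def E_def)
    then have "time_deriv n (additional_flow l k S) = (- 1) *\<^sub>R time_deriv n (A * S)"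
      by (simp only: time_deriv_scaleR)
    then have "time_deriv n (additional_flow l k S) = - (time_deriv n A * S + A * time_deriv n S)"
      by (simp only: time_deriv_mult scaleR_minus1_left)
    also have "\<dots> = (A * neg_part B - neg_part ((B - neg_part B) * E - E * (B - neg_part B))) * S"
      by (simp add: dS dA left_diff_distrib mult.assoc)
    also have "\<dots> = (neg_part (A * B) - neg_part (B * A) + neg_part B * A) * S"
      unfolding A_def commutator_neg_part ..
    also have "\<dots> = H0 A + H1 1"
      by (simp add: H0_def H1_def distrib_right left_diff_distrib mult.assoc)
    finally show ?thesis .
  qed
  show ?thesis
    unfolding commutes_with_kdv_flow_def has_flow_derivative_def
  proof (intro allI)
    fix c i
    obtain p0 where p0: "(\<forall>r. coef (nth (H0 (R r)) c) i = poly p0 (of_real r)) \<and>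
        coeff p0 0 = coef (nth (H0 1) c) i \<and> coeff p0 1 = coef (nth (H0 A) c) i"
      using resolvent_polynomial[OF H(1) A] unfolding R_def by (rule exE)
    obtain p1 where p1: "(\<forall>r. coef (nth (H1 (R r)) c) i = poly p1 (of_real r)) \<and>
        coeff p1 0 = coef (nth (H1 1) c) i \<and> coeff p1 1 = coef (nth (H1 A) c) i"
      using resolvent_polynomial[OF H(2) A] unfolding R_def by (rule exE)
    obtain p2 where p2: "(\<forall>r. coef (nth (H2 (R r)) c) i = poly p2 (of_real r)) \<and>
        coeff p2 0 = coef (nth (H2 1) c) i \<and> coeff p2 1 = coef (nth (H2 A) c) i"
      using resolvent_polynomial[OF H(3) A] unfolding R_def by (rule exE)
    show "\<exists>p. (\<forall>r. coef (nth (kdv_flow n (S + r *\<^sub>R additional_flow l k S)) c) i = poly p (of_real r)) \<and>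
        coeff p 1 = coef (nth (time_deriv n (additional_flow l k S)) c) i"
    \<comment> \<open>Each \<open>pCons 0\<close> is a factor r, so the linear coefficient is that
      of \<open>p0\<close> plus the constant one of \<open>p1\<close>.\<close>
    proof (intro exI[of _ "p0 + pCons 0 p1 + pCons 0 (pCons 0 p2)"] conjI allI)
      fix r :: real
      show "coef (nth (kdv_flow n (S + r *\<^sub>R additional_flow l k S)) c) i =
          poly (p0 + pCons 0 p1 + pCons 0 (pCons 0 p2)) (of_real r)"
        by (simp add: flow p0 p1 p2 scaleR_conv_of_real[where 'a = 'a] mult.assoc)
    next
      show "coeff (p0 + pCons 0 p1 + pCons 0 (pCons 0 p2)) 1 =
          coef (nth (time_deriv n (additional_flow l k S)) c) i"
        using p0 p1 by (simp add: X)
    qed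
  qed
qed

end
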